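(* Let $(\mathcal{A},\Sigma)$ be a PIE indexing pair. If a weight $W:\mathcal{A}\to\mathcal{C}at$ satisfies that $W$-weighted 2-limits are the same as $\sigma$-s-limits with respect to $\Sigma$ (resp. as $\sigma$-s-oplimits with respect to $\Sigma$), then $W$ is a PIE weight.
   Context: **Indexing pairs.** An indexing pair $(\mathcal{A},\Sigma)$ is a (small) 2-category $\mathcal{A}$ with a family $\Sigma$ of its arrows, closed under composition and containing all identities. It is PIE if, in the 1-subcategory of $\mathcal{A}$ given by all objects of $\mathcal{A}$ and the arrows of $\Sigma$, each connected component has an initial object. **$\sigma$-s-limits.** Let $F:\mathcal{A}\to\mathcal{B}$ be a 2-functor and $E\in\mathcal{B}$. A lax cone for $F$ with vertex $E$ consists of arrows $\theta_A:E\to FA$ and 2-cells $\theta_f:Ff\,\theta_A\Rightarrow\theta_B$ (for $f:A\to B$) such that $\theta_{id_A}=id_{\theta_A}$; $\theta_{gf}=\theta_g\circ Fg\,\theta_f$ for $A\xrightarrow{f}B\xrightarrow{g}C$; and $\theta_f=\theta_g\circ F\gamma\,\theta_A$ for $\gamma:f\Rightarrow g:A\to B$. A morphism $\alpha:\theta\to\theta'$ is a family $\alpha_A:\theta_A\Rightarrow\theta'_A$ with $\theta'_f\circ Ff\,\alpha_A=\alpha_B\circ\theta_f$. A $\sigma$-s-cone is a lax cone with $\theta_f$ an identity for every $f\in\Sigma$ (full subcategory). The $\sigma$-s-limit of $F$ with respect to $\Sigma$ is a universal $\sigma$-s-cone $\pi$ with vertex $L$: for each $E$, composition with $\pi$ is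 an isomorphism of categories from $\mathcal{B}(E,L)$ to the category of $\sigma$-s-cones with vertex $E$. Op-lax cones, $\sigma$-s-opcones and $\sigma$-s-oplimits are defined analogously with the structural 2-cells reversed ($\theta_f:\theta_B\Rightarrow Ff\,\theta_A$). **Weighted limits.** For $W:\mathcal{A}\to\mathcal{C}at$ and $F:\mathcal{A}\to\mathcal{B}$ 2-functors, the weighted 2-limit $\{W,F\}$ is defined by isomorphisms of categories $\mathcal{B}(E,\{W,F\})\cong[\mathcal{A},\mathcal{C}at](W,\mathcal{B}(E,F-))$, 2-natural in $E$. "$W$-weighted limits are the same as $\sigma$-s-limits" means that, for every 2-functor $F$ with domain $\mathcal{A}$, the universal properties defining $\{W,F\}$ and the $\sigma$-s-limit of $F$ are equivalent, i.e. $[\mathcal{A},\mathcal{C}at](W,\mathcal{B}(E,F-))$ is naturally isomorphic to the category of $\sigma$-s-cones for $F$ with vertex $E$ (and similarly for $\sigma$-s-oplimits). **PIE weights.** A weight $W:\mathcal{A}\to\mathcal{C}at$ is PIE if, in the category with objects the pairs $(x,A)$, $A\in\mathcal{A}$, $x$ an object of $WA$, and arrows $(x,A)\to(y,B)$ the arrows $f:A\to B$ of $\mathcal{A}$ with $Wf(x)=y$, each connected component has an initial object. *)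

theory Defs
  imports "HOL-Library.FuncSet"
begin

text \<open>
  Objects, arrows and 2-cells are elements of explicit carrier sets. Everything that has to be
  compared by equality (functors, natural transformations, modifications, cones) is made
  extensional, i.e. takes the value \<open>undefined\<close> outside its carrier.
  Compositions are written in applicative order: \<open>Cmp C g f\<close> is "first \<open>f\<close>, then \<open>g\<close>".
\<close>

section \<open>Categories, functors, natural transformations\<close>

record ('o, 'm) cat =
  Obj :: "'o set"
  Arr :: "'m set"
  Dom :: "'m \<Rightarrow> 'o"
  Cod :: "'m \<Rightarrow> 'o"
  Idt :: "'o \<Rightarrow> 'm"
  Cmp :: "'m \<Rightarrow> 'm \<Rightarrow> 'm"

definition category :: "('o, 'm) cat \<Rightarrow> bool" where
  "category C \<longleftrightarrow>
     (\<forall>f\<in>Arr C. Dom C f \<in> Obj C \<and> Cod C f \<in> Obj C) \<and>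
     (\<forall>X\<in>Obj C. Idt C X \<in> Arr C \<and> Dom C (Idt C X) = X \<and> Cod C (Idt C X) = X) \<and>
     (\<forall>f\<in>Arr C. \<forall>g\<in>Arr C. Dom C g = Cod C f \<longrightarrow>
        Cmp C g f \<in> Arr C \<and> Dom C (Cmp C g f) = Dom C f \<and> Cod C (Cmp C g f) = Cod C g) \<and>
     (\<forall>f\<in>Arr C. Cmp C f (Idt C (Dom C f)) = f \<and> Cmp C (Idt C (Cod C f)) f = f) \<and>
     (\<forall>f\<in>Arr C. \<forall>g\<in>Arr C. \<forall>h\<in>Arr C. Dom C g = Cod C f \<longrightarrow> Dom C h = Cod C g \<longrightarrow>
        Cmp C h (Cmp C g f) = Cmp C (Cmp C h g) f)"

record ('o, 'm, 'p, 'n) func =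
  FDom :: "('o, 'm) cat"
  FCod :: "('p, 'n) cat"
  FOb :: "'o \<Rightarrow> 'p"
  FAr :: "'m \<Rightarrow> 'n"

definition is_functor :: "('o, 'm, 'p, 'n) func \<Rightarrow> bool" where
  "is_functor F \<longleftrightarrow>
     category (FDom F) \<and> category (FCod F) \<and>
     FOb F \<in> Obj (FDom F) \<rightarrow>\<^sub>E Obj (FCod F) \<and>
     FAr F \<in> Arr (FDom F) \<rightarrow>\<^sub>E Arr (FCod F) \<and>
     (\<forall>f\<in>Arr (FDom F). Dom (FCod F) (FAr F f) = FOb F (Dom (FDom F) f) \<and>
        Cod (FCod F) (FAr F f) = FOb F (Cod (FDom F) f)) \<and>
     (\<forall>X\<in>Obj (FDom F). FAr F (Idt (FDom F) X) = Idt (FCod F) (FOb F X)) \<and>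
     (\<forall>f\<in>Arr (FDom F). \<forall>g\<in>Arr (FDom F). Dom (FDom F) g = Cod (FDom F) f \<longrightarrow>
        FAr F (Cmp (FDom F) g f) = Cmp (FCod F) (FAr F g) (FAr F f))"

definition fid :: "('o, 'm) cat \<Rightarrow> ('o, 'm, 'o, 'm) func" where
  "fid C = \<lparr>FDom = C, FCod = C, FOb = (\<lambda>X\<in>Obj C. X), FAr = (\<lambda>f\<in>Arr C. f)\<rparr>"

definition fcomp ::
  "('p, 'n, 'q, 'k) func \<Rightarrow> ('o, 'm, 'p, 'n) func \<Rightarrow> ('o, 'm, 'q, 'k) func" where
  "fcomp G F = \<lparr>FDom = FDom F, FCod = FCod G,
     FOb = (\<lambda>X\<in>Obj (FDom F). FOb G (FOb F X)),
     FAr = (\<lambda>f\<in>Arr (FDom F). FAr G (FAr F f))\<rparr>"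

definition iso_functor :: "('o, 'm, 'p, 'n) func \<Rightarrow> bool" where
  "iso_functor F \<longleftrightarrow> is_functor F \<and>
     (\<exists>G. is_functor G \<and> FDom G = FCod F \<and> FCod G = FDom F \<and>
        fcomp G F = fid (FDom F) \<and> fcomp F G = fid (FCod F))"

text \<open>
  A family of components together with its declared source and target; used for natural
  transformations, for modifications and for morphisms of cones, so that each of them
  determines its source and target.
\<close>

record ('s, 'f) fam =
  Src :: 's
  Tgt :: 's
  At :: 'f

type_synonym ('o, 'm, 'p, 'n) nattr = "(('o, 'm, 'p, 'n) func, 'o \<Rightarrow> 'n) fam"

definition is_nattr :: "('o, 'm, 'p, 'n) nattr \<Rightarrow> bool" where
  "is_nattr t \<longleftrightarrow>
     is_functor (Src t) \<and> is_functor (Tgt t) \<and>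
     FDom (Tgt t) = FDom (Src t) \<and> FCod (Tgt t) = FCod (Src t) \<and>
     At t \<in> Obj (FDom (Src t)) \<rightarrow>\<^sub>E Arr (FCod (Src t)) \<and>
     (\<forall>X\<in>Obj (FDom (Src t)). Dom (FCod (Src t)) (At t X) = FOb (Src t) X \<and>
        Cod (FCod (Src t)) (At t X) = FOb (Tgt t) X) \<and>
     (\<forall>f\<in>Arr (FDom (Src t)).
        Cmp (FCod (Src t)) (FAr (Tgt t) f) (At t (Dom (FDom (Src t)) f)) =
        Cmp (FCod (Src t)) (At t (Cod (FDom (Src t)) f)) (FAr (Src t) f))"

definition nid :: "('o, 'm, 'p, 'n) func \<Rightarrow> ('o, 'm, 'p, 'n) nattr" where
  "nid F = \<lparr>Src = F, Tgt = F, At = (\<lambda>X\<in>Obj (FDom F). Idt (FCod F) (FOb F X))\<rparr>"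

definition nvcomp ::
  "('o, 'm, 'p, 'n) nattr \<Rightarrow> ('o, 'm, 'p, 'n) nattr \<Rightarrow> ('o, 'm, 'p, 'n) nattr" where
  "nvcomp t s = \<lparr>Src = Src s, Tgt = Tgt t,
     At = (\<lambda>X\<in>Obj (FDom (Src s)). Cmp (FCod (Src s)) (At t X) (At s X))\<rparr>"

definition nhcomp ::
  "('p, 'n, 'q, 'k) nattr \<Rightarrow> ('o, 'm, 'p, 'n) nattr \<Rightarrow> ('o, 'm, 'q, 'k) nattr" where
  "nhcomp t s = \<lparr>Src = fcomp (Src t) (Src s), Tgt = fcomp (Tgt t) (Tgt s),
     At = (\<lambda>X\<in>Obj (FDom (Src s)).
       Cmp (FCod (Src t)) (At t (FOb (Tgt s) X)) (FAr (Src t) (At s X)))\<rparr>"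


section \<open>Connected components and initial objects\<close>

definition full_subcat :: "('o, 'm) cat \<Rightarrow> 'o set \<Rightarrow> ('o, 'm) cat" where
  "full_subcat C K = C\<lparr>Obj := K, Arr := {f \<in> Arr C. Dom C f \<in> K \<and> Cod C f \<in> K}\<rparr>"

definition connected_rel :: "('o, 'm) cat \<Rightarrow> 'o rel" where
  "connected_rel C =
     {(X, Y) \<in> Obj C \<times> Obj C. \<exists>f\<in>Arr C. Dom C f = X \<and> Cod C f = Y \<or> Dom C f = Y \<and> Cod C f = X}\<^sup>*
     \<inter> Obj C \<times> Obj C"

definition connected_components :: "('o, 'm) cat \<Rightarrow> 'o set set" where
  "connected_components C = Obj C // connected_rel C"

definition initial_object :: "('o, 'm) cat \<Rightarrow> 'o \<Rightarrow> bool" where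
  "initial_object C I \<longleftrightarrow>
     I \<in> Obj C \<and> (\<forall>X\<in>Obj C. \<exists>!f. f \<in> Arr C \<and> Dom C f = I \<and> Cod C f = X)"

definition components_have_initial :: "('o, 'm) cat \<Rightarrow> bool" where
  "components_have_initial C \<longleftrightarrow>
     (\<forall>K\<in>connected_components C. \<exists>I. initial_object (full_subcat C K) I)"


section \<open>2-categories and 2-functors\<close>

record ('o, 'a, 'c) two_cat =
  Ob :: "'o set"
  Ar :: "'a set"
  Ce :: "'c set"
  Dom1 :: "'a \<Rightarrow> 'o"
  Cod1 :: "'a \<Rightarrow> 'o"
  Dom2 :: "'c \<Rightarrow> 'a"
  Cod2 :: "'c \<Rightarrow> 'a"
  Id1 :: "'o \<Rightarrow> 'a"
  Id2 :: "'a \<Rightarrow> 'c"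
  Comp :: "'a \<Rightarrow> 'a \<Rightarrow> 'a"
  VComp :: "'c \<Rightarrow> 'c \<Rightarrow> 'c"
  HComp :: "'c \<Rightarrow> 'c \<Rightarrow> 'c"

definition cat1 :: "('o, 'a, 'c) two_cat \<Rightarrow> ('o, 'a) cat" where
  "cat1 B = \<lparr>Obj = Ob B, Arr = Ar B, Dom = Dom1 B, Cod = Cod1 B, Idt = Id1 B, Cmp = Comp B\<rparr>"

definition vert_cat :: "('o, 'a, 'c) two_cat \<Rightarrow> ('a, 'c) cat" where
  "vert_cat B = \<lparr>Obj = Ar B, Arr = Ce B, Dom = Dom2 B, Cod = Cod2 B, Idt = Id2 B, Cmp = VComp B\<rparr>"

definition horiz_cat :: "('o, 'a, 'c) two_cat \<Rightarrow> ('o, 'c) cat" where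
  "horiz_cat B = \<lparr>Obj = Ob B, Arr = Ce B,
     Dom = (\<lambda>\<gamma>. Dom1 B (Dom2 B \<gamma>)), Cod = (\<lambda>\<gamma>. Cod1 B (Dom2 B \<gamma>)),
     Idt = (\<lambda>X. Id2 B (Id1 B X)), Cmp = HComp B\<rparr>"

definition two_category :: "('o, 'a, 'c) two_cat \<Rightarrow> bool" where
  "two_category B \<longleftrightarrow>
     category (cat1 B) \<and> category (vert_cat B) \<and> category (horiz_cat B) \<and>
     (\<forall>\<gamma>\<in>Ce B. Dom1 B (Cod2 B \<gamma>) = Dom1 B (Dom2 B \<gamma>) \<and> Cod1 B (Cod2 B \<gamma>) = Cod1 B (Dom2 B \<gamma>)) \<and>
     (\<forall>\<gamma>\<in>Ce B. \<forall>\<delta>\<in>Ce B. Dom1 B (Dom2 B \<delta>) = Cod1 B (Dom2 B \<gamma>) \<longrightarrow>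
        Dom2 B (HComp B \<delta> \<gamma>) = Comp B (Dom2 B \<delta>) (Dom2 B \<gamma>) \<and>
        Cod2 B (HComp B \<delta> \<gamma>) = Comp B (Cod2 B \<delta>) (Cod2 B \<gamma>)) \<and>
     (\<forall>f\<in>Ar B. \<forall>g\<in>Ar B. Dom1 B g = Cod1 B f \<longrightarrow>
        HComp B (Id2 B g) (Id2 B f) = Id2 B (Comp B g f)) \<and>
     (\<forall>\<gamma>\<in>Ce B. \<forall>\<gamma>'\<in>Ce B. \<forall>\<delta>\<in>Ce B. \<forall>\<delta>'\<in>Ce B.
        Dom2 B \<gamma>' = Cod2 B \<gamma> \<longrightarrow> Dom2 B \<delta>' = Cod2 B \<delta> \<longrightarrow>
        Dom1 B (Dom2 B \<delta>) = Cod1 B (Dom2 B \<gamma>) \<longrightarrow>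
        HComp B (VComp B \<delta>' \<delta>) (VComp B \<gamma>' \<gamma>) = VComp B (HComp B \<delta>' \<gamma>') (HComp B \<delta> \<gamma>))"

definition op2 :: "('o, 'a, 'c) two_cat \<Rightarrow> ('o, 'a, 'c) two_cat" where
  "op2 B = B\<lparr>Dom1 := Cod1 B, Cod1 := Dom1 B,
     Comp := (\<lambda>g f. Comp B f g), HComp := (\<lambda>\<delta> \<gamma>. HComp B \<gamma> \<delta>)\<rparr>"

text \<open>The 2-category of all categories whose objects and arrows are drawn from two given types.\<close>

definition Cat2 ::
  "(('x, 'y) cat, ('x, 'y, 'x, 'y) func, ('x, 'y, 'x, 'y) nattr) two_cat" where
  "Cat2 = \<lparr>Ob = {C. category C}, Ar = {F. is_functor F}, Ce = {t. is_nattr t},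
     Dom1 = FDom, Cod1 = FCod, Dom2 = Src, Cod2 = Tgt, Id1 = fid, Id2 = nid,
     Comp = fcomp, VComp = nvcomp, HComp = nhcomp\<rparr>"

record ('o, 'a, 'c, 'p, 'q, 'r) two_func =
  F0 :: "'o \<Rightarrow> 'p"
  F1 :: "'a \<Rightarrow> 'q"
  F2 :: "'c \<Rightarrow> 'r"

type_synonym ('o, 'a, 'c, 'x, 'y) cat_valued =
  "('o, 'a, 'c, ('x, 'y) cat, ('x, 'y, 'x, 'y) func, ('x, 'y, 'x, 'y) nattr) two_func"

definition two_functor ::
  "('o, 'a, 'c) two_cat \<Rightarrow> ('p, 'q, 'r) two_cat \<Rightarrow> ('o, 'a, 'c, 'p, 'q, 'r) two_func \<Rightarrow> bool" where
  "two_functor A B F \<longleftrightarrow>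
     (\<forall>X\<in>Ob A. F0 F X \<in> Ob B \<and> F1 F (Id1 A X) = Id1 B (F0 F X)) \<and>
     (\<forall>f\<in>Ar A. F1 F f \<in> Ar B \<and> Dom1 B (F1 F f) = F0 F (Dom1 A f) \<and>
        Cod1 B (F1 F f) = F0 F (Cod1 A f) \<and> F2 F (Id2 A f) = Id2 B (F1 F f)) \<and>
     (\<forall>f\<in>Ar A. \<forall>g\<in>Ar A. Dom1 A g = Cod1 A f \<longrightarrow>
        F1 F (Comp A g f) = Comp B (F1 F g) (F1 F f)) \<and>
     (\<forall>\<gamma>\<in>Ce A. F2 F \<gamma> \<in> Ce B \<and> Dom2 B (F2 F \<gamma>) = F1 F (Dom2 A \<gamma>) \<and>
        Cod2 B (F2 F \<gamma>) = F1 F (Cod2 A \<gamma>)) \<and>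
     (\<forall>\<gamma>\<in>Ce A. \<forall>\<delta>\<in>Ce A. Dom2 A \<delta> = Cod2 A \<gamma> \<longrightarrow>
        F2 F (VComp A \<delta> \<gamma>) = VComp B (F2 F \<delta>) (F2 F \<gamma>)) \<and>
     (\<forall>\<gamma>\<in>Ce A. \<forall>\<delta>\<in>Ce A. Dom1 A (Dom2 A \<delta>) = Cod1 A (Dom2 A \<gamma>) \<longrightarrow>
        F2 F (HComp A \<delta> \<gamma>) = HComp B (F2 F \<delta>) (F2 F \<gamma>))"

text \<open>
  2-natural transformations and modifications between \<open>Cat2\<close>-valued 2-functors. The two
  2-functors may take values in categories over different types, so that a weight can be
  compared with the hom-categories of an arbitrary 2-category.
\<close>

definition two_natural ::
  "('o, 'a, 'c) two_cat \<Rightarrow> ('o, 'a, 'c, 'x, 'y) cat_valued \<Rightarrow> ('o, 'a, 'c, 'u, 'v) cat_valued \<Rightarrow>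
   ('o \<Rightarrow> ('x, 'y, 'u, 'v) func) \<Rightarrow> bool" where
  "two_natural A G H \<alpha> \<longleftrightarrow>
     \<alpha> \<in> extensional (Ob A) \<and>
     (\<forall>X\<in>Ob A. is_functor (\<alpha> X) \<and> FDom (\<alpha> X) = F0 G X \<and> FCod (\<alpha> X) = F0 H X) \<and>
     (\<forall>f\<in>Ar A. fcomp (F1 H f) (\<alpha> (Dom1 A f)) = fcomp (\<alpha> (Cod1 A f)) (F1 G f)) \<and>
     (\<forall>\<gamma>\<in>Ce A. nhcomp (F2 H \<gamma>) (nid (\<alpha> (Dom1 A (Dom2 A \<gamma>)))) =
        nhcomp (nid (\<alpha> (Cod1 A (Dom2 A \<gamma>)))) (F2 G \<gamma>))"

type_synonym ('o, 'x, 'y, 'u, 'v) modif =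
  "('o \<Rightarrow> ('x, 'y, 'u, 'v) func, 'o \<Rightarrow> ('x, 'y, 'u, 'v) nattr) fam"

definition is_modif ::
  "('o, 'a, 'c) two_cat \<Rightarrow> ('o, 'a, 'c, 'x, 'y) cat_valued \<Rightarrow> ('o, 'a, 'c, 'u, 'v) cat_valued \<Rightarrow>
   ('o, 'x, 'y, 'u, 'v) modif \<Rightarrow> bool" where
  "is_modif A G H m \<longleftrightarrow>
     two_natural A G H (Src m) \<and> two_natural A G H (Tgt m) \<and> At m \<in> extensional (Ob A) \<and>
     (\<forall>X\<in>Ob A. is_nattr (At m X) \<and> Src (At m X) = Src m X \<and> Tgt (At m X) = Tgt m X) \<and>
     (\<forall>f\<in>Ar A. nhcomp (nid (F1 H f)) (At m (Dom1 A f)) = nhcomp (At m (Cod1 A f)) (nid (F1 G f)))"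

definition two_nat_cat ::
  "('o, 'a, 'c) two_cat \<Rightarrow> ('o, 'a, 'c, 'x, 'y) cat_valued \<Rightarrow> ('o, 'a, 'c, 'u, 'v) cat_valued \<Rightarrow>
   ('o \<Rightarrow> ('x, 'y, 'u, 'v) func, ('o, 'x, 'y, 'u, 'v) modif) cat" where
  "two_nat_cat A G H = \<lparr>Obj = {\<alpha>. two_natural A G H \<alpha>}, Arr = {m. is_modif A G H m},
     Dom = Src, Cod = Tgt,
     Idt = (\<lambda>\<alpha>. \<lparr>Src = \<alpha>, Tgt = \<alpha>, At = (\<lambda>X\<in>Ob A. nid (\<alpha> X))\<rparr>),
     Cmp = (\<lambda>n m. \<lparr>Src = Src m, Tgt = Tgt n, At = (\<lambda>X\<in>Ob A. nvcomp (At n X) (At m X))\<rparr>)\<rparr>"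

text \<open>
  A 2-natural isomorphism is a 2-natural transformation all of whose components are
  isomorphisms of categories.
\<close>

definition two_nat_isomorphic ::
  "('o, 'a, 'c) two_cat \<Rightarrow> ('o, 'a, 'c, 'x, 'y) cat_valued \<Rightarrow> ('o, 'a, 'c, 'u, 'v) cat_valued \<Rightarrow> bool"
  where
  "two_nat_isomorphic A G H \<longleftrightarrow>
     (\<exists>\<Phi>. two_natural A G H \<Phi> \<and> (\<forall>X\<in>Ob A. iso_functor (\<Phi> X)))"


section \<open>Weighted limits: the right-hand side of the universal property\<close>

definition hom_cat :: "('p, 'q, 'r) two_cat \<Rightarrow> 'p \<Rightarrow> 'p \<Rightarrow> ('q, 'r) cat" where
  "hom_cat B X Y = \<lparr>Obj = {f \<in> Ar B. Dom1 B f = X \<and> Cod1 B f = Y},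
     Arr = {\<gamma> \<in> Ce B. Dom1 B (Dom2 B \<gamma>) = X \<and> Cod1 B (Dom2 B \<gamma>) = Y},
     Dom = Dom2 B, Cod = Cod2 B, Idt = Id2 B, Cmp = VComp B\<rparr>"

text \<open>\<open>postcomp B E g\<close> is \<open>B(E,g)\<close>, and \<open>precomp B X u\<close> is \<open>B(u,X)\<close>; similarly for 2-cells.\<close>

definition postcomp :: "('p, 'q, 'r) two_cat \<Rightarrow> 'p \<Rightarrow> 'q \<Rightarrow> ('q, 'r, 'q, 'r) func" where
  "postcomp B E g = \<lparr>FDom = hom_cat B E (Dom1 B g), FCod = hom_cat B E (Cod1 B g),
     FOb = (\<lambda>h\<in>Obj (hom_cat B E (Dom1 B g)). Comp B g h),
     FAr = (\<lambda>\<gamma>\<in>Arr (hom_cat B E (Dom1 B g)). HComp B (Id2 B g) \<gamma>)\<rparr>"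

definition postcomp2 :: "('p, 'q, 'r) two_cat \<Rightarrow> 'p \<Rightarrow> 'r \<Rightarrow> ('q, 'r, 'q, 'r) nattr" where
  "postcomp2 B E \<delta> = \<lparr>Src = postcomp B E (Dom2 B \<delta>), Tgt = postcomp B E (Cod2 B \<delta>),
     At = (\<lambda>h\<in>Obj (hom_cat B E (Dom1 B (Dom2 B \<delta>))). HComp B \<delta> (Id2 B h))\<rparr>"

definition precomp :: "('p, 'q, 'r) two_cat \<Rightarrow> 'p \<Rightarrow> 'q \<Rightarrow> ('q, 'r, 'q, 'r) func" where
  "precomp B X u = \<lparr>FDom = hom_cat B (Cod1 B u) X, FCod = hom_cat B (Dom1 B u) X,
     FOb = (\<lambda>h\<in>Obj (hom_cat B (Cod1 B u) X). Comp B h u),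
     FAr = (\<lambda>\<gamma>\<in>Arr (hom_cat B (Cod1 B u) X). HComp B \<gamma> (Id2 B u))\<rparr>"

definition precomp2 :: "('p, 'q, 'r) two_cat \<Rightarrow> 'p \<Rightarrow> 'r \<Rightarrow> ('q, 'r, 'q, 'r) nattr" where
  "precomp2 B X \<mu> = \<lparr>Src = precomp B X (Dom2 B \<mu>), Tgt = precomp B X (Cod2 B \<mu>),
     At = (\<lambda>h\<in>Obj (hom_cat B (Cod1 B (Dom2 B \<mu>)) X). HComp B (Id2 B h) \<mu>)\<rparr>"

text \<open>The 2-functor \<open>B(E,F-)\<close>.\<close>

definition hom_functor ::
  "('p, 'q, 'r) two_cat \<Rightarrow> ('o, 'a, 'c, 'p, 'q, 'r) two_func \<Rightarrow> 'p \<Rightarrow> ('o, 'a, 'c, 'q, 'r) cat_valued"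
  where
  "hom_functor B F E = \<lparr>F0 = (\<lambda>X. hom_cat B E (F0 F X)), F1 = (\<lambda>f. postcomp B E (F1 F f)),
     F2 = (\<lambda>\<gamma>. postcomp2 B E (F2 F \<gamma>))\<rparr>"

text \<open>The 2-functor \<open>E \<mapsto> [A,Cat](W, B(E,F-))\<close> on the 1-cell dual of \<open>B\<close>.\<close>

definition weighted_cones1 ::
  "('o, 'a, 'c) two_cat \<Rightarrow> ('o, 'a, 'c, 'x, 'y) cat_valued \<Rightarrow> ('p, 'q, 'r) two_cat \<Rightarrow>
   ('o, 'a, 'c, 'p, 'q, 'r) two_func \<Rightarrow> 'q \<Rightarrow>
   ('o \<Rightarrow> ('x, 'y, 'q, 'r) func, ('o, 'x, 'y, 'q, 'r) modif,
    'o \<Rightarrow> ('x, 'y, 'q, 'r) func, ('o, 'x, 'y, 'q, 'r) modif) func" where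
  "weighted_cones1 A W B F u =
     (let C = two_nat_cat A W (hom_functor B F (Cod1 B u));
          D = two_nat_cat A W (hom_functor B F (Dom1 B u));
          act = (\<lambda>\<alpha>. \<lambda>X\<in>Ob A. fcomp (precomp B (F0 F X) u) (\<alpha> X))
      in \<lparr>FDom = C, FCod = D, FOb = (\<lambda>\<alpha>\<in>Obj C. act \<alpha>),
          FAr = (\<lambda>m\<in>Arr C. \<lparr>Src = act (Src m), Tgt = act (Tgt m),
            At = (\<lambda>X\<in>Ob A. nhcomp (nid (precomp B (F0 F X) u)) (At m X))\<rparr>)\<rparr>)"

definition weighted_cones ::
  "('o, 'a, 'c) two_cat \<Rightarrow> ('o, 'a, 'c, 'x, 'y) cat_valued \<Rightarrow> ('p, 'q, 'r) two_cat \<Rightarrow>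
   ('o, 'a, 'c, 'p, 'q, 'r) two_func \<Rightarrow>
   ('p, 'q, 'r, 'o \<Rightarrow> ('x, 'y, 'q, 'r) func, ('o, 'x, 'y, 'q, 'r) modif) cat_valued" where
  "weighted_cones A W B F = \<lparr>F0 = (\<lambda>E. two_nat_cat A W (hom_functor B F E)),
     F1 = weighted_cones1 A W B F,
     F2 = (\<lambda>\<mu>. let S = weighted_cones1 A W B F (Dom2 B \<mu>); T = weighted_cones1 A W B F (Cod2 B \<mu>)
       in \<lparr>Src = S, Tgt = T, At = (\<lambda>\<alpha>\<in>Obj (FDom S). \<lparr>Src = FOb S \<alpha>, Tgt = FOb T \<alpha>,
            At = (\<lambda>X\<in>Ob A. nhcomp (precomp2 B (F0 F X) \<mu>) (nid (\<alpha> X)))\<rparr>)\<rparr>)\<rparr>"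


section \<open>Lax and op-lax cones\<close>

record ('o, 'a, 'q, 'r) cone =
  Leg :: "'o \<Rightarrow> 'q"
  Str :: "'a \<Rightarrow> 'r"

type_synonym ('o, 'a, 'q, 'r) cone_mor = "(('o, 'a, 'q, 'r) cone, 'o \<Rightarrow> 'r) fam"

definition lax_cone ::
  "('o, 'a, 'c) two_cat \<Rightarrow> ('p, 'q, 'r) two_cat \<Rightarrow> ('o, 'a, 'c, 'p, 'q, 'r) two_func \<Rightarrow> 'p \<Rightarrow>
   ('o, 'a, 'q, 'r) cone \<Rightarrow> bool" where
  "lax_cone A B F E \<theta> \<longleftrightarrow>
     Leg \<theta> \<in> extensional (Ob A) \<and> Str \<theta> \<in> extensional (Ar A) \<and>
     (\<forall>X\<in>Ob A. Leg \<theta> X \<in> Ar B \<and> Dom1 B (Leg \<theta> X) = E \<and> Cod1 B (Leg \<theta> X) = F0 F X) \<and>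
     (\<forall>f\<in>Ar A. Str \<theta> f \<in> Ce B \<and> Dom2 B (Str \<theta> f) = Comp B (F1 F f) (Leg \<theta> (Dom1 A f)) \<and>
        Cod2 B (Str \<theta> f) = Leg \<theta> (Cod1 A f)) \<and>
     (\<forall>X\<in>Ob A. Str \<theta> (Id1 A X) = Id2 B (Leg \<theta> X)) \<and>
     (\<forall>f\<in>Ar A. \<forall>g\<in>Ar A. Dom1 A g = Cod1 A f \<longrightarrow>
        Str \<theta> (Comp A g f) = VComp B (Str \<theta> g) (HComp B (Id2 B (F1 F g)) (Str \<theta> f))) \<and>
     (\<forall>\<gamma>\<in>Ce A. Str \<theta> (Dom2 A \<gamma>) =
        VComp B (Str \<theta> (Cod2 A \<gamma>)) (HComp B (F2 F \<gamma>) (Id2 B (Leg \<theta> (Dom1 A (Dom2 A \<gamma>))))))"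

definition oplax_cone ::
  "('o, 'a, 'c) two_cat \<Rightarrow> ('p, 'q, 'r) two_cat \<Rightarrow> ('o, 'a, 'c, 'p, 'q, 'r) two_func \<Rightarrow> 'p \<Rightarrow>
   ('o, 'a, 'q, 'r) cone \<Rightarrow> bool" where
  "oplax_cone A B F E \<theta> \<longleftrightarrow>
     Leg \<theta> \<in> extensional (Ob A) \<and> Str \<theta> \<in> extensional (Ar A) \<and>
     (\<forall>X\<in>Ob A. Leg \<theta> X \<in> Ar B \<and> Dom1 B (Leg \<theta> X) = E \<and> Cod1 B (Leg \<theta> X) = F0 F X) \<and>
     (\<forall>f\<in>Ar A. Str \<theta> f \<in> Ce B \<and> Dom2 B (Str \<theta> f) = Leg \<theta> (Cod1 A f) \<and>
        Cod2 B (Str \<theta> f) = Comp B (F1 F f) (Leg \<theta> (Dom1 A f))) \<and>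
     (\<forall>X\<in>Ob A. Str \<theta> (Id1 A X) = Id2 B (Leg \<theta> X)) \<and>
     (\<forall>f\<in>Ar A. \<forall>g\<in>Ar A. Dom1 A g = Cod1 A f \<longrightarrow>
        Str \<theta> (Comp A g f) = VComp B (HComp B (Id2 B (F1 F g)) (Str \<theta> f)) (Str \<theta> g)) \<and>
     (\<forall>\<gamma>\<in>Ce A. Str \<theta> (Cod2 A \<gamma>) =
        VComp B (HComp B (F2 F \<gamma>) (Id2 B (Leg \<theta> (Dom1 A (Dom2 A \<gamma>))))) (Str \<theta> (Dom2 A \<gamma>)))"

definition cone_family ::
  "('o, 'a, 'c) two_cat \<Rightarrow> ('p, 'q, 'r) two_cat \<Rightarrow> ('o, 'a, 'q, 'r) cone_mor \<Rightarrow> bool" where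
  "cone_family A B m \<longleftrightarrow> At m \<in> extensional (Ob A) \<and>
     (\<forall>X\<in>Ob A. At m X \<in> Ce B \<and> Dom2 B (At m X) = Leg (Src m) X \<and> Cod2 B (At m X) = Leg (Tgt m) X)"

definition lax_cone_mor ::
  "('o, 'a, 'c) two_cat \<Rightarrow> ('p, 'q, 'r) two_cat \<Rightarrow> ('o, 'a, 'c, 'p, 'q, 'r) two_func \<Rightarrow>
   ('o, 'a, 'q, 'r) cone_mor \<Rightarrow> bool" where
  "lax_cone_mor A B F m \<longleftrightarrow> cone_family A B m \<and>
     (\<forall>f\<in>Ar A. VComp B (Str (Tgt m) f) (HComp B (Id2 B (F1 F f)) (At m (Dom1 A f))) =
        VComp B (At m (Cod1 A f)) (Str (Src m) f))"

definition oplax_cone_mor ::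
  "('o, 'a, 'c) two_cat \<Rightarrow> ('p, 'q, 'r) two_cat \<Rightarrow> ('o, 'a, 'c, 'p, 'q, 'r) two_func \<Rightarrow>
   ('o, 'a, 'q, 'r) cone_mor \<Rightarrow> bool" where
  "oplax_cone_mor A B F m \<longleftrightarrow> cone_family A B m \<and>
     (\<forall>f\<in>Ar A. VComp B (HComp B (Id2 B (F1 F f)) (At m (Dom1 A f))) (Str (Src m) f) =
        VComp B (Str (Tgt m) f) (At m (Cod1 A f)))"

definition cone_cat ::
  "('o, 'a, 'c) two_cat \<Rightarrow> ('p, 'q, 'r) two_cat \<Rightarrow>
   (('o, 'a, 'q, 'r) cone \<Rightarrow> bool) \<Rightarrow> (('o, 'a, 'q, 'r) cone_mor \<Rightarrow> bool) \<Rightarrow>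
   (('o, 'a, 'q, 'r) cone, ('o, 'a, 'q, 'r) cone_mor) cat" where
  "cone_cat A B P M = \<lparr>Obj = {\<theta>. P \<theta>}, Arr = {m. P (Src m) \<and> P (Tgt m) \<and> M m},
     Dom = Src, Cod = Tgt,
     Idt = (\<lambda>\<theta>. \<lparr>Src = \<theta>, Tgt = \<theta>, At = (\<lambda>X\<in>Ob A. Id2 B (Leg \<theta> X))\<rparr>),
     Cmp = (\<lambda>n m. \<lparr>Src = Src m, Tgt = Tgt n, At = (\<lambda>X\<in>Ob A. VComp B (At n X) (At m X))\<rparr>)\<rparr>"

text \<open>
  For cones, \<open>Str \<theta> f\<close> being the identity of the leg at the codomain of \<open>f\<close> says both that the
  triangle at \<open>f\<close> commutes strictly and that its structural 2-cell is an identity.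
\<close>

definition sigma_s_cones ::
  "('o, 'a, 'c) two_cat \<Rightarrow> 'a set \<Rightarrow> ('p, 'q, 'r) two_cat \<Rightarrow> ('o, 'a, 'c, 'p, 'q, 'r) two_func \<Rightarrow> 'p \<Rightarrow>
   (('o, 'a, 'q, 'r) cone, ('o, 'a, 'q, 'r) cone_mor) cat" where
  "sigma_s_cones A S B F E =
     cone_cat A B (\<lambda>\<theta>. lax_cone A B F E \<theta> \<and> (\<forall>f\<in>S. Str \<theta> f = Id2 B (Leg \<theta> (Cod1 A f))))
       (lax_cone_mor A B F)"

definition sigma_s_opcones ::
  "('o, 'a, 'c) two_cat \<Rightarrow> 'a set \<Rightarrow> ('p, 'q, 'r) two_cat \<Rightarrow> ('o, 'a, 'c, 'p, 'q, 'r) two_func \<Rightarrow> 'p \<Rightarrow>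
   (('o, 'a, 'q, 'r) cone, ('o, 'a, 'q, 'r) cone_mor) cat" where
  "sigma_s_opcones A S B F E =
     cone_cat A B (\<lambda>\<theta>. oplax_cone A B F E \<theta> \<and> (\<forall>f\<in>S. Str \<theta> f = Id2 B (Leg \<theta> (Cod1 A f))))
       (oplax_cone_mor A B F)"

text \<open>
  Given the categories \<open>K E\<close> of cones with vertex \<open>E\<close>, the 2-functor \<open>E \<mapsto> K E\<close> on the 1-cell
  dual of \<open>B\<close>, with arrows and 2-cells of \<open>B\<close> acting by precomposition.
\<close>

definition cones1 ::
  "('o, 'a, 'c) two_cat \<Rightarrow> ('p, 'q, 'r) two_cat \<Rightarrow>
   ('p \<Rightarrow> (('o, 'a, 'q, 'r) cone, ('o, 'a, 'q, 'r) cone_mor) cat) \<Rightarrow> 'q \<Rightarrow>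
   (('o, 'a, 'q, 'r) cone, ('o, 'a, 'q, 'r) cone_mor,
    ('o, 'a, 'q, 'r) cone, ('o, 'a, 'q, 'r) cone_mor) func" where
  "cones1 A B K u =
     (let C = K (Cod1 B u);
          act = (\<lambda>\<theta>. \<lparr>Leg = (\<lambda>X\<in>Ob A. Comp B (Leg \<theta> X) u),
                      Str = (\<lambda>f\<in>Ar A. HComp B (Str \<theta> f) (Id2 B u))\<rparr>)
      in \<lparr>FDom = C, FCod = K (Dom1 B u), FOb = (\<lambda>\<theta>\<in>Obj C. act \<theta>),
          FAr = (\<lambda>m\<in>Arr C. \<lparr>Src = act (Src m), Tgt = act (Tgt m),
            At = (\<lambda>X\<in>Ob A. HComp B (At m X) (Id2 B u))\<rparr>)\<rparr>)"

definition cones ::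
  "('o, 'a, 'c) two_cat \<Rightarrow> ('p, 'q, 'r) two_cat \<Rightarrow>
   ('p \<Rightarrow> (('o, 'a, 'q, 'r) cone, ('o, 'a, 'q, 'r) cone_mor) cat) \<Rightarrow>
   ('p, 'q, 'r, ('o, 'a, 'q, 'r) cone, ('o, 'a, 'q, 'r) cone_mor) cat_valued" where
  "cones A B K = \<lparr>F0 = K, F1 = cones1 A B K,
     F2 = (\<lambda>\<mu>. let S = cones1 A B K (Dom2 B \<mu>); T = cones1 A B K (Cod2 B \<mu>)
       in \<lparr>Src = S, Tgt = T, At = (\<lambda>\<theta>\<in>Obj (FDom S). \<lparr>Src = FOb S \<theta>, Tgt = FOb T \<theta>,
            At = (\<lambda>X\<in>Ob A. HComp B (Id2 B (Leg \<theta> X)) \<mu>)\<rparr>)\<rparr>)\<rparr>"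


section \<open>Indexing pairs, weights, and the comparison of the two kinds of limits\<close>

definition indexing_pair :: "('o, 'a, 'c) two_cat \<Rightarrow> 'a set \<Rightarrow> bool" where
  "indexing_pair A S \<longleftrightarrow> two_category A \<and> S \<subseteq> Ar A \<and> (\<forall>X\<in>Ob A. Id1 A X \<in> S) \<and>
     (\<forall>f\<in>S. \<forall>g\<in>S. Dom1 A g = Cod1 A f \<longrightarrow> Comp A g f \<in> S)"

definition PIE_indexing_pair :: "('o, 'a, 'c) two_cat \<Rightarrow> 'a set \<Rightarrow> bool" where
  "PIE_indexing_pair A S \<longleftrightarrow>
     indexing_pair A S \<and> components_have_initial ((cat1 A)\<lparr>Arr := S\<rparr>)"

definition elements_cat ::
  "('o, 'a, 'c) two_cat \<Rightarrow> ('o, 'a, 'c, 'x, 'y) cat_valued \<Rightarrow>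
   ('x \<times> 'o, ('x \<times> 'o) \<times> 'a \<times> ('x \<times> 'o)) cat" where
  "elements_cat A W = \<lparr>Obj = {(x, X). X \<in> Ob A \<and> x \<in> Obj (F0 W X)},
     Arr = {((x, X), f, (y, Y)). f \<in> Ar A \<and> Dom1 A f = X \<and> Cod1 A f = Y \<and>
              x \<in> Obj (F0 W X) \<and> FOb (F1 W f) x = y},
     Dom = (\<lambda>(s, f, t). s), Cod = (\<lambda>(s, f, t). t),
     Idt = (\<lambda>(x, X). ((x, X), Id1 A X, (x, X))),
     Cmp = (\<lambda>(s', g, t') (s, f, t). (s, Comp A g f, t'))\<rparr>"

definition PIE_weight ::
  "('o, 'a, 'c) two_cat \<Rightarrow> ('o, 'a, 'c, 'x, 'y) cat_valued \<Rightarrow> bool" where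
  "PIE_weight A W \<longleftrightarrow> components_have_initial (elements_cat A W)"

text \<open>
  For a fixed \<open>F\<close>: the categories \<open>[A,Cat](W, B(E,F-))\<close> and the categories of cones with
  vertex \<open>E\<close> are isomorphic, 2-naturally in \<open>E\<close>, so that the universal properties of the
  weighted limit and of the sigma-s-(op)limit agree. No compatibility between the isomorphisms
  for different \<open>F\<close> is asked for. "For every 2-functor \<open>F\<close> with domain \<open>A\<close>" becomes a quantifier
  over all 2-categories \<open>B\<close> whose cells are drawn from one type; since types cannot be
  quantified inside a formula, that type is a parameter, any type into which the cells of \<open>A\<close>,
  the objects and arrows of the categories \<open>W X\<close>, and the natural numbers can be injected.
  It may be taken large enough to contain \<open>Cat2\<close> and the 2-categories of \<open>Cat2\<close>-valued 2-functors.
\<close>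

definition weighted_limit_is_sigma_s_limit ::
  "('o, 'a, 'c) two_cat \<Rightarrow> 'a set \<Rightarrow> ('o, 'a, 'c, 'x, 'y) cat_valued \<Rightarrow> ('p, 'q, 'r) two_cat \<Rightarrow>
   ('o, 'a, 'c, 'p, 'q, 'r) two_func \<Rightarrow> bool" where
  "weighted_limit_is_sigma_s_limit A S W B F \<longleftrightarrow>
     two_nat_isomorphic (op2 B) (weighted_cones A W B F) (cones A B (sigma_s_cones A S B F))"

definition weighted_limit_is_sigma_s_oplimit ::
  "('o, 'a, 'c) two_cat \<Rightarrow> 'a set \<Rightarrow> ('o, 'a, 'c, 'x, 'y) cat_valued \<Rightarrow> ('p, 'q, 'r) two_cat \<Rightarrow>
   ('o, 'a, 'c, 'p, 'q, 'r) two_func \<Rightarrow> bool" where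
  "weighted_limit_is_sigma_s_oplimit A S W B F \<longleftrightarrow>
     two_nat_isomorphic (op2 B) (weighted_cones A W B F) (cones A B (sigma_s_opcones A S B F))"

end

theory Submission
  imports Defs
begin

text \<open>
  Regard a 1-category \<open>C\<close> as a 2-category with exactly one 2-cell between any two parallel arrows.
  For a functor \<open>F : A \<rightarrow> C\<close>, weighted cones \<open>W \<Rightarrow> C(E,F-)\<close> are then families of arrows
  indexed by the objects of the categories \<open>W X\<close> and natural with respect to the arrows of \<open>A\<close>, while
  \<open>\<sigma>\<close>-s-cones and \<open>\<sigma>\<close>-s-opcones both are families \<open>\<theta>\<^sub>X : E \<rightarrow> F X\<close> strictly compatible over
  \<open>\<Sigma>\<close>. So only the presheaf \<open>P = Ob \<circ> W\<close> matters, and one wants to see that it is a sum of representables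
  \<open>A(I,-)\<close> with \<open>I\<close> initial in a component of \<open>\<Sigma>\<close>.

  The Yoneda argument is not available directly: the comparison of cones is natural only inside one
  \<open>C\<close>, which is no larger than \<open>A\<close> and \<open>W\<close>, so that \<open>C\<close> need not have room for all natural
  transformations between the presheaves involved. Instead, let \<open>C\<close> be \<open>A\<close> with one further object
  \<open>*\<close>, where \<open>C(*,X)\<close> is \<open>T X = (P X + \<Sum>\<^sub>Y A(Y,X)) \<times> 2 + 1\<close>, and where the endomorphisms of \<open>*\<close>
  are the few endomorphisms of \<open>T\<close> in \<open>M\<close> below. The factor \<open>2\<close> makes the comparison respect the relation
  "\<open>a'\<close> arises from \<open>a\<close> by replacing some values by the base point", which isolates single
  components. If \<open>d\<close> corresponds to the inclusion \<open>P \<rightarrow> T\<close> and \<open>q\<close> to the family \<open>I \<rightarrow> X\<close> of initial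
  arrows in \<open>\<Sigma>\<close>, then every \<open>q\<^sub>X(x)\<close> is an arrow \<open>g : I \<rightarrow> X\<close> with \<open>P g (d\<^sub>I) = x\<close>, and \<open>g\<close> is the
  only such arrow: \<open>(d\<^sub>I, I)\<close> is initial in the component of \<open>(x, X)\<close>.
\<close>

section \<open>Components with an initial object\<close>

text \<open>\<open>\<rho>\<close> picks the initial object of each component. Each \<open>X\<close>
  is joined to \<open>\<rho> X\<close> by an arrow, and invariance along arrows extends to zigzags,
  so \<open>\<rho>\<close> is constant on components. This replaces the closure relation by
  conditions on single arrows.\<close>

lemma components_have_initial_iff:
  assumes arr: "\<And>f. f \<in> Arr C \<Longrightarrow> Dom C f \<in> Obj C \<and> Cod C f \<in> Obj C"
  shows "components_have_initial C \<longleftrightarrow>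
    (\<exists>\<rho>. (\<forall>X\<in>Obj C. \<rho> X \<in> Obj C \<and> (\<exists>!f. f \<in> Arr C \<and> Dom C f = \<rho> X \<and> Cod C f = X)) \<and>
         (\<forall>f\<in>Arr C. \<rho> (Dom C f) = \<rho> (Cod C f)))"
proof -
  define r where "r = {(X, Y) \<in> Obj C \<times> Obj C. \<exists>f\<in>Arr C. Dom C f = X \<and> Cod C f = Y \<or> Dom C f = Y \<and> Cod C f = X}"
  define c where "c = connected_rel C"
  have c: "c = r\<^sup>* \<inter> Obj C \<times> Obj C"
    by (simp add: c_def connected_rel_def r_def)
  have "sym r" by (auto simp: r_def sym_def)
  then have symc: "sym c" unfolding c by (auto dest: sym_rtrancl intro!: symI elim: symE)
  have transc: "trans c" unfolding c by (auto intro!: transI)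
  have reflc: "(X, X) \<in> c" if "X \<in> Obj C" for X using that by (simp add: c)
  have arrc: "(Dom C f, Cod C f) \<in> c" if "f \<in> Arr C" for f
    using that arr[OF that] unfolding c r_def by (auto intro!: r_into_rtrancl)
  show ?thesis
  proof
    assume init: "components_have_initial C"
    define \<rho> where "\<rho> X = (SOME I. initial_object (full_subcat C (c `` {X})) I)" for X
    have \<rho>: "initial_object (full_subcat C (c `` {X})) (\<rho> X)" if "X \<in> Obj C" for X
    proof -
      have "c `` {X} \<in> connected_components C"
        using that by (auto simp: connected_components_def c_def intro: quotientI)
      then show ?thesis
        using init unfolding \<rho>_def components_have_initial_def by (metis someI_ex)
    qed
    have "\<rho> X \<in> Obj C \<and> (\<exists>!f. f \<in> Arr C \<and> Dom C f = \<rho> X \<and> Cod C f = X)" if X: "X \<in> Obj C" for X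
    proof -
      have 1: "\<rho> X \<in> c `` {X}" and
        2: "\<exists>!f. f \<in> Arr C \<and> Dom C f \<in> c `` {X} \<and> Cod C f \<in> c `` {X} \<and> Dom C f = \<rho> X \<and> Cod C f = X"
        using \<rho>[OF X] reflc[OF X] by (auto simp: initial_object_def full_subcat_def)
      have "\<rho> X \<in> Obj C" using 1 by (simp add: c)
      moreover have "X \<in> c `` {X}" using reflc[OF X] by simp
      ultimately show ?thesis using 1 2 by metis
    qed
    moreover have "\<rho> (Dom C f) = \<rho> (Cod C f)" if "f \<in> Arr C" for f
    proof -
      have "c `` {Dom C f} = c `` {Cod C f}"
        using arrc[OF that] symc transc by (auto dest: symD transD)
      then show ?thesis by (simp add: \<rho>_def)
    qed
    ultimately show "\<exists>\<rho>. (\<forall>X\<in>Obj C. \<rho> X \<in> Obj C \<and> (\<exists>!f. f \<in> Arr C \<and> Dom C f = \<rho> X \<and> Cod C f = X)) \<and>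
         (\<forall>f\<in>Arr C. \<rho> (Dom C f) = \<rho> (Cod C f))" by blast
  next
    assume "\<exists>\<rho>. (\<forall>X\<in>Obj C. \<rho> X \<in> Obj C \<and> (\<exists>!f. f \<in> Arr C \<and> Dom C f = \<rho> X \<and> Cod C f = X)) \<and>
         (\<forall>f\<in>Arr C. \<rho> (Dom C f) = \<rho> (Cod C f))"
    then obtain \<rho> where \<rho>: "\<And>X. X \<in> Obj C \<Longrightarrow> \<rho> X \<in> Obj C"
        "\<And>X. X \<in> Obj C \<Longrightarrow> \<exists>!f. f \<in> Arr C \<and> Dom C f = \<rho> X \<and> Cod C f = X"
        and inv: "\<And>f. f \<in> Arr C \<Longrightarrow> \<rho> (Dom C f) = \<rho> (Cod C f)" by blast
    have const: "\<rho> Y = \<rho> X" if "(X, Y) \<in> c" for X Y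
    proof -
      have "(X, Y) \<in> r\<^sup>*" using that by (simp add: c)
      then show ?thesis by induction (auto simp: r_def inv)
    qed
    show "components_have_initial C" unfolding components_have_initial_def
    proof
      fix K assume "K \<in> connected_components C"
      then obtain X where X: "X \<in> Obj C" and K: "K = c `` {X}"
        by (auto simp: connected_components_def c_def quotient_def)
      have "\<rho> X \<in> K"
        using \<rho>[OF X] arrc symc unfolding K by (metis Image_singleton_iff symE)
      moreover have "\<exists>!f. f \<in> Arr C \<and> Dom C f \<in> K \<and> Cod C f \<in> K \<and> Dom C f = \<rho> X \<and> Cod C f = Y" if "Y \<in> K" for Y
      proof -
        have "Y \<in> Obj C" "\<rho> Y = \<rho> X" using that const by (auto simp: K c)
        then show ?thesis using \<rho>(2)[of Y] \<open>\<rho> X \<in> K\<close> that by metis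
      qed
      ultimately have "initial_object (full_subcat C K) (\<rho> X)"
        by (auto simp: initial_object_def full_subcat_def conj_assoc)
      then show "\<exists>I. initial_object (full_subcat C K) I" ..
    qed
  qed
qed

section \<open>Locally chaotic 2-categories\<close>

text \<open>The unbundled counterpart of \<open>is_functor\<close>, without extensionality, because
  the maps \<open>F0\<close> and \<open>F1\<close> of a 2-functor are not extensional
  either.\<close>

definition functorial :: "('o, 'm) cat \<Rightarrow> ('p, 'n) cat \<Rightarrow> ('o \<Rightarrow> 'p) \<Rightarrow> ('m \<Rightarrow> 'n) \<Rightarrow> bool" where
  "functorial C D G0 G1 \<longleftrightarrow>
     (\<forall>X\<in>Obj C. G0 X \<in> Obj D \<and> G1 (Idt C X) = Idt D (G0 X)) \<and>
     (\<forall>f\<in>Arr C. G1 f \<in> Arr D \<and> Dom D (G1 f) = G0 (Dom C f) \<and> Cod D (G1 f) = G0 (Cod C f)) \<and>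
     (\<forall>f\<in>Arr C. \<forall>g\<in>Arr C. Dom C g = Cod C f \<longrightarrow> G1 (Cmp C g f) = Cmp D (G1 g) (G1 f))"

text \<open>The 2-cell between the parallel arrows \<open>f\<close> and \<open>g\<close> is \<open>k (f, g)\<close>.\<close>

definition chaotic :: "('q \<times> 'q \<Rightarrow> 'r) \<Rightarrow> ('p, 'q) cat \<Rightarrow> ('p, 'q, 'r) two_cat" where
  "chaotic k C = \<lparr>Ob = Obj C, Ar = Arr C,
     Ce = k ` {(f, g). f \<in> Arr C \<and> g \<in> Arr C \<and> Dom C f = Dom C g \<and> Cod C f = Cod C g},
     Dom1 = Dom C, Cod1 = Cod C, Dom2 = (\<lambda>c. fst (inv k c)), Cod2 = (\<lambda>c. snd (inv k c)),
     Id1 = Idt C, Id2 = (\<lambda>f. k (f, f)), Comp = Cmp C,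
     VComp = (\<lambda>d c. k (fst (inv k c), snd (inv k d))),
     HComp = (\<lambda>d c. k (Cmp C (fst (inv k d)) (fst (inv k c)), Cmp C (snd (inv k d)) (snd (inv k c))))\<rparr>"

text \<open>\<open>F2\<close> has no freedom: a 2-cell of \<open>chaotic k C\<close> is determined
  by its source and target.\<close>

definition chaotic_ext ::
  "('o, 'a, 'c) two_cat \<Rightarrow> ('q \<times> 'q \<Rightarrow> 'r) \<Rightarrow> ('o \<Rightarrow> 'p) \<Rightarrow> ('a \<Rightarrow> 'q) \<Rightarrow> ('o, 'a, 'c, 'p, 'q, 'r) two_func" where
  "chaotic_ext A k G0 G1 = \<lparr>F0 = G0, F1 = G1, F2 = (\<lambda>\<gamma>. k (G1 (Dom2 A \<gamma>), G1 (Cod2 A \<gamma>)))\<rparr>"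

lemma categoryD:
  assumes "category C"
  shows "f \<in> Arr C \<Longrightarrow> Dom C f \<in> Obj C" "f \<in> Arr C \<Longrightarrow> Cod C f \<in> Obj C"
    "X \<in> Obj C \<Longrightarrow> Idt C X \<in> Arr C" "X \<in> Obj C \<Longrightarrow> Dom C (Idt C X) = X" "X \<in> Obj C \<Longrightarrow> Cod C (Idt C X) = X"
    "f \<in> Arr C \<Longrightarrow> g \<in> Arr C \<Longrightarrow> Dom C g = Cod C f \<Longrightarrow> Cmp C g f \<in> Arr C"
    "f \<in> Arr C \<Longrightarrow> g \<in> Arr C \<Longrightarrow> Dom C g = Cod C f \<Longrightarrow> Dom C (Cmp C g f) = Dom C f"
    "f \<in> Arr C \<Longrightarrow> g \<in> Arr C \<Longrightarrow> Dom C g = Cod C f \<Longrightarrow> Cod C (Cmp C g f) = Cod C g"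
    "f \<in> Arr C \<Longrightarrow> X = Dom C f \<Longrightarrow> Cmp C f (Idt C X) = f"
    "f \<in> Arr C \<Longrightarrow> X = Cod C f \<Longrightarrow> Cmp C (Idt C X) f = f"
    "f \<in> Arr C \<Longrightarrow> g \<in> Arr C \<Longrightarrow> h \<in> Arr C \<Longrightarrow> Dom C g = Cod C f \<Longrightarrow> Dom C h = Cod C g \<Longrightarrow>
       Cmp C (Cmp C h g) f = Cmp C h (Cmp C g f)"
  using assms unfolding category_def by simp_all

lemma two_category_chaotic:
  assumes C: "category C" and k: "inj k"
  shows "two_category (chaotic k C)"
  unfolding two_category_def category_def
  by (auto simp: chaotic_def cat1_def vert_cat_def horiz_cat_def inv_f_f[OF k] categoryD[OF C])

lemma two_functor_chaotic_ext:
  assumes "two_category A" "category C" and k: "inj k" and G: "functorial (cat1 A) C G0 G1"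
  shows "two_functor A (chaotic k C) (chaotic_ext A k G0 G1)"
proof -
  have A: "category (cat1 A)" "category (vert_cat A)" "category (horiz_cat A)"
    "\<forall>\<gamma>\<in>Ce A. Dom1 A (Cod2 A \<gamma>) = Dom1 A (Dom2 A \<gamma>) \<and> Cod1 A (Cod2 A \<gamma>) = Cod1 A (Dom2 A \<gamma>)"
    "\<forall>\<gamma>\<in>Ce A. \<forall>\<delta>\<in>Ce A. Dom1 A (Dom2 A \<delta>) = Cod1 A (Dom2 A \<gamma>) \<longrightarrow>
        Dom2 A (HComp A \<delta> \<gamma>) = Comp A (Dom2 A \<delta>) (Dom2 A \<gamma>) \<and>
        Cod2 A (HComp A \<delta> \<gamma>) = Comp A (Cod2 A \<delta>) (Cod2 A \<gamma>)"
    using assms(1) unfolding two_category_def by blast+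
  note A1 = categoryD[OF A(1), unfolded cat1_def, simplified]
  note A2 = categoryD[OF A(2), unfolded vert_cat_def, simplified]
  show ?thesis
    using G A1 A2 A(4,5) unfolding two_functor_def functorial_def
    by (auto simp: chaotic_def chaotic_ext_def cat1_def inv_f_f[OF k])
qed

text \<open>A natural transformation from the presheaf of objects of \<open>W\<close> to
  \<open>C(E,G-)\<close>.\<close>

definition elt_cone ::
  "('o, 'a, 'c) two_cat \<Rightarrow> ('o, 'a, 'c, 'x, 'y) cat_valued \<Rightarrow> ('p, 'q) cat \<Rightarrow> ('o \<Rightarrow> 'p) \<Rightarrow> ('a \<Rightarrow> 'q) \<Rightarrow>
   'p \<Rightarrow> ('o \<Rightarrow> 'x \<Rightarrow> 'q) \<Rightarrow> bool" where
  "elt_cone A W C G0 G1 E \<alpha> \<longleftrightarrow>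
     (\<forall>X\<in>Ob A. \<forall>x\<in>Obj (F0 W X). \<alpha> X x \<in> Arr C \<and> Dom C (\<alpha> X x) = E \<and> Cod C (\<alpha> X x) = G0 X) \<and>
     (\<forall>f\<in>Ar A. \<forall>x\<in>Obj (F0 W (Dom1 A f)).
        \<alpha> (Cod1 A f) (FOb (F1 W f) x) = Cmp C (G1 f) (\<alpha> (Dom1 A f) x))"

text \<open>Arrows outside \<open>S\<close> impose no equation: in the chaotic 2-category their
  triangle is filled by exactly one 2-cell, in either direction.\<close>

definition strict_cone ::
  "('o, 'a, 'c) two_cat \<Rightarrow> 'a set \<Rightarrow> ('p, 'q) cat \<Rightarrow> ('o \<Rightarrow> 'p) \<Rightarrow> ('a \<Rightarrow> 'q) \<Rightarrow>
   'p \<Rightarrow> ('o \<Rightarrow> 'q) \<Rightarrow> bool" where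
  "strict_cone A S C G0 G1 E \<theta> \<longleftrightarrow>
     (\<forall>X\<in>Ob A. \<theta> X \<in> Arr C \<and> Dom C (\<theta> X) = E \<and> Cod C (\<theta> X) = G0 X) \<and>
     (\<forall>f\<in>S. Cmp C (G1 f) (\<theta> (Dom1 A f)) = \<theta> (Cod1 A f))"

text \<open>
  The comparison of cones as a relation. The families are not extensional, hence the equalities are
  only asked for at the relevant indices.
\<close>

definition same_cones ::
  "('o, 'a, 'c) two_cat \<Rightarrow> 'a set \<Rightarrow> ('o, 'a, 'c, 'x, 'y) cat_valued \<Rightarrow> ('p, 'q) cat \<Rightarrow>
   ('o \<Rightarrow> 'p) \<Rightarrow> ('a \<Rightarrow> 'q) \<Rightarrow> ('p \<Rightarrow> ('o \<Rightarrow> 'x \<Rightarrow> 'q) \<Rightarrow> ('o \<Rightarrow> 'q) \<Rightarrow> bool) \<Rightarrow> bool" where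
  "same_cones A S W C G0 G1 R \<longleftrightarrow>
     (\<forall>E\<in>Obj C.
       (\<forall>\<alpha>. elt_cone A W C G0 G1 E \<alpha> \<longrightarrow> (\<exists>\<theta>. strict_cone A S C G0 G1 E \<theta> \<and> R E \<alpha> \<theta>)) \<and>
       (\<forall>\<theta>. strict_cone A S C G0 G1 E \<theta> \<longrightarrow> (\<exists>\<alpha>. elt_cone A W C G0 G1 E \<alpha> \<and> R E \<alpha> \<theta>)) \<and>
       (\<forall>\<alpha> \<alpha>' \<theta> \<theta>'. elt_cone A W C G0 G1 E \<alpha> \<longrightarrow> elt_cone A W C G0 G1 E \<alpha>' \<longrightarrow>
          strict_cone A S C G0 G1 E \<theta> \<longrightarrow> strict_cone A S C G0 G1 E \<theta>' \<longrightarrow> R E \<alpha> \<theta> \<longrightarrow> R E \<alpha>' \<theta>' \<longrightarrow>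
          ((\<forall>X\<in>Ob A. \<forall>x\<in>Obj (F0 W X). \<alpha> X x = \<alpha>' X x) \<longleftrightarrow> (\<forall>X\<in>Ob A. \<theta> X = \<theta>' X)))) \<and>
     (\<forall>u\<in>Arr C. \<forall>\<alpha> \<theta> \<alpha>' \<theta>'. elt_cone A W C G0 G1 (Cod C u) \<alpha> \<longrightarrow>
        strict_cone A S C G0 G1 (Cod C u) \<theta> \<longrightarrow> R (Cod C u) \<alpha> \<theta> \<longrightarrow>
        (\<forall>X\<in>Ob A. \<forall>x\<in>Obj (F0 W X). \<alpha>' X x = Cmp C (\<alpha> X x) u) \<longrightarrow>
        (\<forall>X\<in>Ob A. \<theta>' X = Cmp C (\<theta> X) u) \<longrightarrow> R (Dom C u) \<alpha>' \<theta>')"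

lemma two_category_category:
  assumes "two_category A"
  shows "category (cat1 A)" "category (vert_cat A)" "category (horiz_cat A)"
    "\<gamma> \<in> Ce A \<Longrightarrow> Dom1 A (Cod2 A \<gamma>) = Dom1 A (Dom2 A \<gamma>)"
    "\<gamma> \<in> Ce A \<Longrightarrow> Cod1 A (Cod2 A \<gamma>) = Cod1 A (Dom2 A \<gamma>)"
  using assms unfolding two_category_def by blast+

lemma two_categoryD1:
  assumes "two_category A"
  shows "f \<in> Ar A \<Longrightarrow> Dom1 A f \<in> Ob A" "f \<in> Ar A \<Longrightarrow> Cod1 A f \<in> Ob A"
    "X \<in> Ob A \<Longrightarrow> Id1 A X \<in> Ar A" "X \<in> Ob A \<Longrightarrow> Dom1 A (Id1 A X) = X" "X \<in> Ob A \<Longrightarrow> Cod1 A (Id1 A X) = X"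
    "f \<in> Ar A \<Longrightarrow> g \<in> Ar A \<Longrightarrow> Dom1 A g = Cod1 A f \<Longrightarrow> Comp A g f \<in> Ar A"
    "f \<in> Ar A \<Longrightarrow> g \<in> Ar A \<Longrightarrow> Dom1 A g = Cod1 A f \<Longrightarrow> Dom1 A (Comp A g f) = Dom1 A f"
    "f \<in> Ar A \<Longrightarrow> g \<in> Ar A \<Longrightarrow> Dom1 A g = Cod1 A f \<Longrightarrow> Cod1 A (Comp A g f) = Cod1 A g"
    "f \<in> Ar A \<Longrightarrow> X = Dom1 A f \<Longrightarrow> Comp A f (Id1 A X) = f"
    "f \<in> Ar A \<Longrightarrow> X = Cod1 A f \<Longrightarrow> Comp A (Id1 A X) f = f"
    "f \<in> Ar A \<Longrightarrow> g \<in> Ar A \<Longrightarrow> h \<in> Ar A \<Longrightarrow> Dom1 A g = Cod1 A f \<Longrightarrow> Dom1 A h = Cod1 A g \<Longrightarrow>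
       Comp A (Comp A h g) f = Comp A h (Comp A g f)"
    "\<gamma> \<in> Ce A \<Longrightarrow> Dom2 A \<gamma> \<in> Ar A" "\<gamma> \<in> Ce A \<Longrightarrow> Cod2 A \<gamma> \<in> Ar A"
  using categoryD[OF two_category_category(1)[OF assms]] categoryD(1,2)[OF two_category_category(2)[OF assms]]
  by (simp_all add: cat1_def vert_cat_def)

lemma weightD:
  assumes "two_functor A Cat2 W"
  shows "X \<in> Ob A \<Longrightarrow> category (F0 W X)"
    "X \<in> Ob A \<Longrightarrow> F1 W (Id1 A X) = fid (F0 W X)"
    "f \<in> Ar A \<Longrightarrow> is_functor (F1 W f)"
    "f \<in> Ar A \<Longrightarrow> FDom (F1 W f) = F0 W (Dom1 A f)"
    "f \<in> Ar A \<Longrightarrow> FCod (F1 W f) = F0 W (Cod1 A f)"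
    "f \<in> Ar A \<Longrightarrow> g \<in> Ar A \<Longrightarrow> Dom1 A g = Cod1 A f \<Longrightarrow> F1 W (Comp A g f) = fcomp (F1 W g) (F1 W f)"
    "\<gamma> \<in> Ce A \<Longrightarrow> is_nattr (F2 W \<gamma>)"
    "\<gamma> \<in> Ce A \<Longrightarrow> Src (F2 W \<gamma>) = F1 W (Dom2 A \<gamma>)"
    "\<gamma> \<in> Ce A \<Longrightarrow> Tgt (F2 W \<gamma>) = F1 W (Cod2 A \<gamma>)"
  using assms unfolding two_functor_def Cat2_def by simp_all

lemma is_functorD:
  assumes "is_functor F"
  shows "x \<in> Obj (FDom F) \<Longrightarrow> FOb F x \<in> Obj (FCod F)"
    "y \<in> Arr (FDom F) \<Longrightarrow> FAr F y \<in> Arr (FCod F)"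
    "y \<in> Arr (FDom F) \<Longrightarrow> Dom (FCod F) (FAr F y) = FOb F (Dom (FDom F) y)"
    "y \<in> Arr (FDom F) \<Longrightarrow> Cod (FCod F) (FAr F y) = FOb F (Cod (FDom F) y)"
  using assms unfolding is_functor_def by auto

lemma iso_functor_bij:
  assumes "iso_functor F"
  shows "bij_betw (FOb F) (Obj (FDom F)) (Obj (FCod F))"
proof -
  obtain G where F: "is_functor F" and G: "is_functor G" "FDom G = FCod F" "FCod G = FDom F"
    and inv: "fcomp G F = fid (FDom F)" "fcomp F G = fid (FCod F)"
    using assms unfolding iso_functor_def by blast
  have "FOb G (FOb F x) = x" if "x \<in> Obj (FDom F)" for x
    using arg_cong[OF inv(1), of "\<lambda>h. FOb h x"] that by (simp add: fcomp_def fid_def)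
  moreover have "FOb F (FOb G x) = x" if "x \<in> Obj (FCod F)" for x
    using arg_cong[OF inv(2), of "\<lambda>h. FOb h x"] that by (simp add: fcomp_def fid_def G)
  ultimately show ?thesis
    using is_functorD(1)[OF F] is_functorD(1)[OF G(1)] G by (intro bij_betw_byWitness[where f' = "FOb G"]) auto
qed

section \<open>Weighted cones with values in a chaotic 2-category\<close>

locale chaotic_cones =
  fixes A :: "('o, 'a, 'c) two_cat" and W :: "('o, 'a, 'c, 'x, 'y) cat_valued"
    and C :: "('p, 'q) cat" and G0 :: "'o \<Rightarrow> 'p" and G1 :: "'a \<Rightarrow> 'q" and k :: "'q \<times> 'q \<Rightarrow> 'r"
  assumes A: "two_category A" and W: "two_functor A Cat2 W" and C: "category C"
    and G: "functorial (cat1 A) C G0 G1" and k: "inj k"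
begin

abbreviation "B \<equiv> chaotic k C"
abbreviation "F \<equiv> chaotic_ext A k G0 G1"

lemmas C_simps = categoryD[OF C]
lemmas A_simps = two_categoryD1[OF A] two_category_category(4,5)[OF A]
lemma W_functor:
  "f \<in> Ar A \<Longrightarrow> x \<in> Obj (F0 W (Dom1 A f)) \<Longrightarrow> FOb (F1 W f) x \<in> Obj (F0 W (Cod1 A f))"
  "f \<in> Ar A \<Longrightarrow> y \<in> Arr (F0 W (Dom1 A f)) \<Longrightarrow> FAr (F1 W f) y \<in> Arr (F0 W (Cod1 A f))"
  "f \<in> Ar A \<Longrightarrow> y \<in> Arr (F0 W (Dom1 A f)) \<Longrightarrow>
     Dom (F0 W (Cod1 A f)) (FAr (F1 W f) y) = FOb (F1 W f) (Dom (F0 W (Dom1 A f)) y)"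
  "f \<in> Ar A \<Longrightarrow> y \<in> Arr (F0 W (Dom1 A f)) \<Longrightarrow>
     Cod (F0 W (Cod1 A f)) (FAr (F1 W f) y) = FOb (F1 W f) (Cod (F0 W (Dom1 A f)) y)"
  using is_functorD[OF weightD(3)[OF W]] by (simp_all add: weightD[OF W])

lemmas W_simps = weightD[OF W] W_functor

lemma G_simps:
  "X \<in> Ob A \<Longrightarrow> G0 X \<in> Obj C" "f \<in> Ar A \<Longrightarrow> G1 f \<in> Arr C"
  "f \<in> Ar A \<Longrightarrow> Dom C (G1 f) = G0 (Dom1 A f)" "f \<in> Ar A \<Longrightarrow> Cod C (G1 f) = G0 (Cod1 A f)"
  "X \<in> Ob A \<Longrightarrow> G1 (Id1 A X) = Idt C (G0 X)"
  "f \<in> Ar A \<Longrightarrow> g \<in> Ar A \<Longrightarrow> Dom1 A g = Cod1 A f \<Longrightarrow> G1 (Comp A g f) = Cmp C (G1 g) (G1 f)"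
  using G unfolding functorial_def cat1_def by simp_all


lemma hom_chaotic:
  "Obj (hom_cat B X Y) = {f \<in> Arr C. Dom C f = X \<and> Cod C f = Y}"
  "Arr (hom_cat B X Y) = k ` (Obj (hom_cat B X Y) \<times> Obj (hom_cat B X Y))"
  "Dom (hom_cat B X Y) (k p) = fst p" "Cod (hom_cat B X Y) (k p) = snd p"
  "Idt (hom_cat B X Y) f = k (f, f)"
  "Cmp (hom_cat B X Y) (k p) (k p') = k (fst p', snd p)"
  by (auto simp: hom_cat_def chaotic_def inv_f_f[OF k])

lemma B_simps [simp]:
  "Ob B = Obj C" "Ar B = Arr C" "Dom1 B = Dom C" "Cod1 B = Cod C" "Comp B = Cmp C" "Id1 B = Idt C"
  "Id2 B f = k (f, f)" "Dom2 B (k p) = fst p" "Cod2 B (k p) = snd p"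
  "VComp B (k p) (k p') = k (fst p', snd p)"
  "HComp B (k p) (k p') = k (Cmp C (fst p) (fst p'), Cmp C (snd p) (snd p'))"
  "F0 F = G0" "F1 F = G1" "F2 F \<gamma> = k (G1 (Dom2 A \<gamma>), G1 (Cod2 A \<gamma>))"
  by (auto simp: chaotic_def chaotic_ext_def inv_f_f[OF k])

lemma k_eq [simp]: "k p = k p' \<longleftrightarrow> p = p'"
  using k by (auto dest: injD)

lemma k_mem [simp]: "k p \<in> k ` M \<longleftrightarrow> p \<in> M"
  by auto

lemma category_hom: "category (hom_cat B X Y)"
  unfolding category_def by (auto simp: hom_chaotic)

text \<open>The hom-categories of \<open>B\<close> are indiscrete, so any map on objects extends
  uniquely to a functor, an arrow \<open>y\<close> going to the only 2-cell with the right
  boundary.\<close>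

definition wcone :: "'p \<Rightarrow> ('o \<Rightarrow> 'x \<Rightarrow> 'q) \<Rightarrow> 'o \<Rightarrow> ('x, 'y, 'q, 'r) func" where
  "wcone E \<alpha> = (\<lambda>X\<in>Ob A. \<lparr>FDom = F0 W X, FCod = hom_cat B E (G0 X),
     FOb = (\<lambda>x\<in>Obj (F0 W X). \<alpha> X x),
     FAr = (\<lambda>y\<in>Arr (F0 W X). k (\<alpha> X (Dom (F0 W X) y), \<alpha> X (Cod (F0 W X) y)))\<rparr>)"

abbreviation "weighted \<equiv> weighted_cones A W B F"
abbreviation "econe \<equiv> elt_cone A W C G0 G1"

lemma hom_functor_simps:
  "F0 (hom_functor B F E) X = hom_cat B E (G0 X)"
  "F1 (hom_functor B F E) f = postcomp B E (G1 f)"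
  "F2 (hom_functor B F E) \<gamma> = postcomp2 B E (k (G1 (Dom2 A \<gamma>), G1 (Cod2 A \<gamma>)))"
  by (simp_all add: hom_functor_def)

lemma wcone_natural1:
  assumes \<alpha>: "econe E \<alpha>" and f: "f \<in> Ar A"
  shows "fcomp (postcomp B E (G1 f)) (wcone E \<alpha> (Dom1 A f)) = fcomp (wcone E \<alpha> (Cod1 A f)) (F1 W f)"
  using \<alpha> f
  by (auto simp: fcomp_def postcomp_def wcone_def elt_cone_def A_simps W_simps G_simps hom_chaotic
      categoryD(1,2)[OF weightD(1)[OF W]] intro!: restrict_ext)

lemma two_natural_wcone:
  assumes \<alpha>: "econe E \<alpha>"
  shows "two_natural A W (hom_functor B F E) (wcone E \<alpha>)"
proof -
  have "is_functor (wcone E \<alpha> X)" if "X \<in> Ob A" for X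
    unfolding is_functor_def
    using \<alpha> that category_hom categoryD[OF weightD(1)[OF W that]] weightD(1)[OF W that]
    by (auto simp: wcone_def hom_chaotic elt_cone_def)
  \<comment> \<open>At each object \<open>x\<close> the two sides are 2-cells with the same source
    and target; the square of \<open>wcone_natural1\<close> at both ends of \<open>\<gamma>\<close>
    identifies these boundaries.\<close>
  moreover have "nhcomp (F2 (hom_functor B F E) \<gamma>) (nid (wcone E \<alpha> (Dom1 A (Dom2 A \<gamma>)))) =
      nhcomp (nid (wcone E \<alpha> (Cod1 A (Dom2 A \<gamma>)))) (F2 W \<gamma>)" if \<gamma>: "\<gamma> \<in> Ce A" for \<gamma>
  proof -
    have f: "Dom2 A \<gamma> \<in> Ar A" "Cod2 A \<gamma> \<in> Ar A" using \<gamma> by (simp_all add: A_simps)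
    have t: "At (F2 W \<gamma>) x \<in> Arr (F0 W (Cod1 A (Dom2 A \<gamma>)))"
      "Dom (F0 W (Cod1 A (Dom2 A \<gamma>))) (At (F2 W \<gamma>) x) = FOb (F1 W (Dom2 A \<gamma>)) x"
      "Cod (F0 W (Cod1 A (Dom2 A \<gamma>))) (At (F2 W \<gamma>) x) = FOb (F1 W (Cod2 A \<gamma>)) x"
      if "x \<in> Obj (F0 W (Dom1 A (Dom2 A \<gamma>)))" for x
      using weightD(7)[OF W \<gamma>] that f unfolding is_nattr_def by (auto simp: W_simps \<gamma>)
    have sq: "fcomp (postcomp B E (G1 (Cod2 A \<gamma>))) (wcone E \<alpha> (Dom1 A (Dom2 A \<gamma>))) =
        fcomp (wcone E \<alpha> (Cod1 A (Dom2 A \<gamma>))) (F1 W (Cod2 A \<gamma>))"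
      using wcone_natural1[OF \<alpha> f(2)] by (simp add: A_simps \<gamma>)
    have \<alpha>1: "\<alpha> X x \<in> Arr C" "Dom C (\<alpha> X x) = E" "Cod C (\<alpha> X x) = G0 X" if "X \<in> Ob A" "x \<in> Obj (F0 W X)" for X x
      using \<alpha> that by (auto simp: elt_cone_def)
    have \<alpha>2: "\<alpha> (Cod1 A (Dom2 A \<gamma>)) (FOb (F1 W f) x) = Cmp C (G1 f) (\<alpha> (Dom1 A (Dom2 A \<gamma>)) x)"
      if "x \<in> Obj (F0 W (Dom1 A (Dom2 A \<gamma>)))" "f = Dom2 A \<gamma> \<or> f = Cod2 A \<gamma>" for x f
      using \<alpha> that f unfolding elt_cone_def by (metis A_simps(14,15) \<gamma>)
    have W1: "FOb (F1 W f) x \<in> Obj (F0 W (Cod1 A (Dom2 A \<gamma>)))"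
      if "x \<in> Obj (F0 W (Dom1 A (Dom2 A \<gamma>)))" "f = Dom2 A \<gamma> \<or> f = Cod2 A \<gamma>" for x f
      using that f W_simps(10)[of f x] by (auto simp: A_simps \<gamma>)
    show ?thesis
      using wcone_natural1[OF \<alpha> f(1)] sq f
      by (auto simp: hom_functor_simps nhcomp_def nid_def postcomp2_def W_simps \<gamma> t wcone_def
          hom_chaotic postcomp_def A_simps \<alpha>1 \<alpha>2 W1 G_simps intro!: restrict_ext)
  qed
  ultimately show ?thesis
    using \<alpha> wcone_natural1[OF \<alpha>]
    by (auto simp: two_natural_def hom_functor_simps) (auto simp: wcone_def)
qed

text \<open>A functor into an indiscrete category can be recovered from its object part, and
  extensionality turns this into an actual equality, so \<open>wcone\<close> reaches every weighted
  cone.\<close>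

lemma two_naturalD:
  assumes t: "two_natural A W (hom_functor B F E) t"
  shows "econe E (\<lambda>X. FOb (t X))" "t = wcone E (\<lambda>X. FOb (t X))"
proof -
  have 1: "t \<in> extensional (Ob A)" "\<And>X. X \<in> Ob A \<Longrightarrow> is_functor (t X)"
    "\<And>X. X \<in> Ob A \<Longrightarrow> FDom (t X) = F0 W X" "\<And>X. X \<in> Ob A \<Longrightarrow> FCod (t X) = hom_cat B E (G0 X)"
    "\<And>f. f \<in> Ar A \<Longrightarrow> fcomp (postcomp B E (G1 f)) (t (Dom1 A f)) = fcomp (t (Cod1 A f)) (F1 W f)"
    using t unfolding two_natural_def hom_functor_simps by auto
  have t1: "x \<in> Obj (F0 W X) \<Longrightarrow> FOb (t X) x \<in> Obj (hom_cat B E (G0 X))"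
    "y \<in> Arr (F0 W X) \<Longrightarrow> FAr (t X) y \<in> Arr (hom_cat B E (G0 X))"
    "y \<in> Arr (F0 W X) \<Longrightarrow> Dom (hom_cat B E (G0 X)) (FAr (t X) y) = FOb (t X) (Dom (F0 W X) y)"
    "y \<in> Arr (F0 W X) \<Longrightarrow> Cod (hom_cat B E (G0 X)) (FAr (t X) y) = FOb (t X) (Cod (F0 W X) y)"
    if "X \<in> Ob A" for X x y
    using is_functorD[OF 1(2)[OF that]] by (simp_all add: 1(3,4) that)
  have "FOb (t (Cod1 A f)) (FOb (F1 W f) x) = Cmp C (G1 f) (FOb (t (Dom1 A f)) x)"
    if "f \<in> Ar A" "x \<in> Obj (F0 W (Dom1 A f))" for f x
    using arg_cong[OF 1(5)[OF that(1)], of "\<lambda>h. FOb h x"] that t1(1)[of "Dom1 A f" x]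
    by (simp add: fcomp_def postcomp_def 1(3) A_simps W_simps hom_chaotic G_simps)
  then show "econe E (\<lambda>X. FOb (t X))"
    using t1(1) by (auto simp: elt_cone_def hom_chaotic)
  show "t = wcone E (\<lambda>X. FOb (t X))"
  proof (rule extensionalityI[OF 1(1)])
    show "wcone E (\<lambda>X. FOb (t X)) \<in> extensional (Ob A)" by (simp add: wcone_def)
    fix X assume X: "X \<in> Ob A"
    have ext: "FOb (t X) \<in> extensional (Obj (F0 W X))" "FAr (t X) \<in> extensional (Arr (F0 W X))"
      using 1(2)[OF X] 1(3)[OF X] unfolding is_functor_def by (auto simp: PiE_def)
    have "FAr (t X) y = k (FOb (t X) (Dom (F0 W X) y), FOb (t X) (Cod (F0 W X) y))"
      if "y \<in> Arr (F0 W X)" for y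
      using t1(2-4)[OF X that] 1(4)[OF X] by (auto simp: hom_chaotic)
    then have "FAr (t X) = FAr (wcone E (\<lambda>X. FOb (t X)) X)"
      using X by (intro extensionalityI[OF ext(2)]) (auto simp: wcone_def)
    moreover have "FOb (t X) = FOb (wcone E (\<lambda>X. FOb (t X)) X)"
      using X by (intro extensionalityI[OF ext(1)]) (auto simp: wcone_def)
    ultimately show "t X = wcone E (\<lambda>X. FOb (t X)) X"
      using X 1(3,4)[OF X] by (cases "t X") (simp add: wcone_def)
  qed
qed

lemma wcone_eq_iff:
  "wcone E \<alpha> = wcone E \<alpha>' \<longleftrightarrow> (\<forall>X\<in>Ob A. \<forall>x\<in>Obj (F0 W X). \<alpha> X x = \<alpha>' X x)"
proof
  assume *: "wcone E \<alpha> = wcone E \<alpha>'"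
  show "\<forall>X\<in>Ob A. \<forall>x\<in>Obj (F0 W X). \<alpha> X x = \<alpha>' X x"
  proof (intro ballI)
    fix X x assume "X \<in> Ob A" "x \<in> Obj (F0 W X)"
    then show "\<alpha> X x = \<alpha>' X x"
      using arg_cong[OF *, of "\<lambda>h. FOb (h X) x"] by (simp add: wcone_def)
  qed
next
  assume "\<forall>X\<in>Ob A. \<forall>x\<in>Obj (F0 W X). \<alpha> X x = \<alpha>' X x"
  then show "wcone E \<alpha> = wcone E \<alpha>'"
    using categoryD(1,2)[OF weightD(1)[OF W]]
    by (auto simp: wcone_def intro!: restrict_ext)
qed

lemma weighted_Obj: "Obj (F0 weighted E) = wcone E ` {\<alpha>. econe E \<alpha>}"
  using two_natural_wcone two_naturalD(1) two_naturalD(2)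
  by (simp add: weighted_cones_def two_nat_cat_def) blast

lemma weighted_act:
  assumes \<alpha>: "econe (Cod C u) \<alpha>" and u: "u \<in> Arr C"
  shows "FOb (F1 weighted u) (wcone (Cod C u) \<alpha>) = wcone (Dom C u) (\<lambda>X x. Cmp C (\<alpha> X x) u)"
proof -
  have "fcomp (precomp B (G0 X) u) (wcone (Cod C u) \<alpha> X) = wcone (Dom C u) (\<lambda>X x. Cmp C (\<alpha> X x) u) X"
    if "X \<in> Ob A" for X
    using that \<alpha> u categoryD(1,2)[OF weightD(1)[OF W]]
    by (auto simp: fcomp_def precomp_def wcone_def hom_chaotic elt_cone_def intro!: restrict_ext)
  then show ?thesis
    using two_natural_wcone[OF \<alpha>]
    by (auto simp: weighted_cones_def weighted_cones1_def Let_def two_nat_cat_def wcone_def[of "Dom C u"]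
        intro!: restrict_ext)
qed


section \<open>Lax and op-lax cones in a chaotic 2-category\<close>

abbreviation "scone S \<equiv> strict_cone A S C G0 G1"

text \<open>\<open>lax\<close> and \<open>oplax\<close> start from the same family of arrows and
  differ only in the direction of the unique structural 2-cell; this is why limits and oplimits
  admit one argument.\<close>

definition lax :: "('o \<Rightarrow> 'q) \<Rightarrow> ('o, 'a, 'q, 'r) cone" where
  "lax \<theta> = \<lparr>Leg = (\<lambda>X\<in>Ob A. \<theta> X),
     Str = (\<lambda>f\<in>Ar A. k (Cmp C (G1 f) (\<theta> (Dom1 A f)), \<theta> (Cod1 A f)))\<rparr>"

definition oplax :: "('o \<Rightarrow> 'q) \<Rightarrow> ('o, 'a, 'q, 'r) cone" where
  "oplax \<theta> = \<lparr>Leg = (\<lambda>X\<in>Ob A. \<theta> X),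
     Str = (\<lambda>f\<in>Ar A. k (\<theta> (Cod1 A f), Cmp C (G1 f) (\<theta> (Dom1 A f))))\<rparr>"

lemma lax_eq_iff: "lax \<theta> = lax \<theta>' \<longleftrightarrow> (\<forall>X\<in>Ob A. \<theta> X = \<theta>' X)"
  using A_simps(1,2) by (auto simp: lax_def fun_eq_iff restrict_def)

lemma oplax_eq_iff: "oplax \<theta> = oplax \<theta>' \<longleftrightarrow> (\<forall>X\<in>Ob A. \<theta> X = \<theta>' X)"
  using A_simps(1,2) by (auto simp: oplax_def fun_eq_iff restrict_def)

text \<open>A structural 2-cell is determined by its boundary, hence by the legs. It is an identity
  exactly when the two boundary arrows coincide, which over \<open>S\<close> is the equation of
  \<open>strict_cone\<close>.\<close>

lemma sigma_s_cones_Obj: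
  assumes S: "S \<subseteq> Ar A"
  shows "Obj (sigma_s_cones A S B F E) = lax ` {\<theta>. scone S E \<theta>}"
proof (intro set_eqI iffI)
  fix c assume "c \<in> Obj (sigma_s_cones A S B F E)"
  then have c: "lax_cone A B F E c" and cS: "\<And>f. f \<in> S \<Longrightarrow> Str c f = Id2 B (Leg c (Cod1 A f))"
    by (auto simp: sigma_s_cones_def cone_cat_def)
  have str: "Str c f = k (Cmp C (G1 f) (Leg c (Dom1 A f)), Leg c (Cod1 A f))" if "f \<in> Ar A" for f
  proof -
    have "Str c f \<in> Ce B" using c that by (simp add: lax_cone_def)
    then obtain p where p: "Str c f = k p" by (auto simp: chaotic_def)
    show ?thesis using c that unfolding lax_cone_def p by (metis B_simps(5,8,9,13) prod.collapse p)
  qed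
  have "scone S E (Leg c)"
    using c cS str S unfolding strict_cone_def lax_cone_def by (auto simp: subset_iff)
  moreover have "c = lax (Leg c)"
    using c str by (cases c) (auto simp: lax_cone_def lax_def extensional_def fun_eq_iff)
  ultimately show "c \<in> lax ` {\<theta>. scone S E \<theta>}" by blast
next
  fix c assume "c \<in> lax ` {\<theta>. scone S E \<theta>}"
  then show "c \<in> Obj (sigma_s_cones A S B F E)"
    using S
    by (auto simp: sigma_s_cones_def cone_cat_def lax_cone_def lax_def strict_cone_def A_simps G_simps C_simps
        subset_iff)
       (auto simp: chaotic_def A_simps G_simps C_simps)
qed

lemma sigma_s_opcones_Obj:
  assumes S: "S \<subseteq> Ar A"
  shows "Obj (sigma_s_opcones A S B F E) = oplax ` {\<theta>. scone S E \<theta>}"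
proof (intro set_eqI iffI)
  fix c assume "c \<in> Obj (sigma_s_opcones A S B F E)"
  then have c: "oplax_cone A B F E c" and cS: "\<And>f. f \<in> S \<Longrightarrow> Str c f = Id2 B (Leg c (Cod1 A f))"
    by (auto simp: sigma_s_opcones_def cone_cat_def)
  have str: "Str c f = k (Leg c (Cod1 A f), Cmp C (G1 f) (Leg c (Dom1 A f)))" if "f \<in> Ar A" for f
  proof -
    have "Str c f \<in> Ce B" using c that by (simp add: oplax_cone_def)
    then obtain p where p: "Str c f = k p" by (auto simp: chaotic_def)
    show ?thesis using c that unfolding oplax_cone_def p by (metis B_simps(5,8,9,13) prod.collapse p)
  qed
  have "scone S E (Leg c)"
    using c cS str S unfolding strict_cone_def oplax_cone_def by (auto simp: subset_iff)
  moreover have "c = oplax (Leg c)"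
    using c str by (cases c) (auto simp: oplax_cone_def oplax_def extensional_def fun_eq_iff)
  ultimately show "c \<in> oplax ` {\<theta>. scone S E \<theta>}" by blast
next
  fix c assume "c \<in> oplax ` {\<theta>. scone S E \<theta>}"
  then show "c \<in> Obj (sigma_s_opcones A S B F E)"
    using S
    by (auto simp: sigma_s_opcones_def cone_cat_def oplax_cone_def oplax_def strict_cone_def A_simps G_simps C_simps
        subset_iff)
       (auto simp: chaotic_def A_simps G_simps C_simps)
qed

lemma lax_act:
  assumes "S \<subseteq> Ar A" "scone S (Cod C u) \<theta>" "u \<in> Arr C"
  shows "FOb (cones1 A B (sigma_s_cones A S B F) u) (lax \<theta>) = lax (\<lambda>X. Cmp C (\<theta> X) u)"
  using assms sigma_s_cones_Obj[OF assms(1)]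
  by (auto simp: cones1_def Let_def lax_def strict_cone_def A_simps G_simps C_simps intro!: restrict_ext)

lemma oplax_act:
  assumes "S \<subseteq> Ar A" "scone S (Cod C u) \<theta>" "u \<in> Arr C"
  shows "FOb (cones1 A B (sigma_s_opcones A S B F) u) (oplax \<theta>) = oplax (\<lambda>X. Cmp C (\<theta> X) u)"
  using assms sigma_s_opcones_Obj[OF assms(1)]
  by (auto simp: cones1_def Let_def oplax_def strict_cone_def A_simps G_simps C_simps intro!: restrict_ext)

text \<open>\<open>R\<close> is the graph of the object part of the 2-natural isomorphism, and its
  stability under precomposition is the naturality square at \<open>u\<close>. The parameters
  \<open>K\<close> and \<open>mk\<close> let the same proof serve cones and opcones.\<close>

lemma same_conesI:
  assumes iso: "two_nat_isomorphic (op2 B) weighted (cones A B K)"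
    and mk: "\<And>E. Obj (K E) = mk ` {\<theta>. scone S E \<theta>}"
    and eq: "\<And>\<theta> \<theta>'. mk \<theta> = mk \<theta>' \<longleftrightarrow> (\<forall>X\<in>Ob A. \<theta> X = \<theta>' X)"
    and act: "\<And>u \<theta>. u \<in> Arr C \<Longrightarrow> scone S (Cod C u) \<theta> \<Longrightarrow>
      FOb (cones1 A B K u) (mk \<theta>) = mk (\<lambda>X. Cmp C (\<theta> X) u)"
  shows "\<exists>R. same_cones A S W C G0 G1 R"
proof -
  obtain \<Phi> where \<Phi>: "two_natural (op2 B) weighted (cones A B K) \<Phi>"
    and isoF: "\<And>E. E \<in> Obj C \<Longrightarrow> iso_functor (\<Phi> E)"
    using iso by (auto simp: two_nat_isomorphic_def op2_def)
  have dom: "FDom (\<Phi> E) = F0 weighted E" "FCod (\<Phi> E) = K E" if "E \<in> Obj C" for E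
    using \<Phi> that by (auto simp: two_natural_def op2_def cones_def)
  have sq: "fcomp (cones1 A B K u) (\<Phi> (Cod C u)) = fcomp (\<Phi> (Dom C u)) (F1 weighted u)" if "u \<in> Arr C" for u
    using \<Phi> that by (simp add: two_natural_def op2_def cones_def)
  have bij: "bij_betw (FOb (\<Phi> E)) (wcone E ` {\<alpha>. econe E \<alpha>}) (mk ` {\<theta>. scone S E \<theta>})" if "E \<in> Obj C" for E
    using iso_functor_bij[OF isoF[OF that]] by (simp add: dom[OF that] weighted_Obj mk)
  define R where "R E \<alpha> \<theta> \<longleftrightarrow> FOb (\<Phi> E) (wcone E \<alpha>) = mk \<theta>" for E \<alpha> \<theta>
  have "same_cones A S W C G0 G1 R"
    unfolding same_cones_def
  proof (intro conjI ballI allI impI)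
    fix E assume E: "E \<in> Obj C"
    show "\<exists>\<theta>. scone S E \<theta> \<and> R E \<alpha> \<theta>" if "econe E \<alpha>" for \<alpha>
      using bij_betw_apply[OF bij[OF E], of "wcone E \<alpha>"] that by (auto simp: R_def)
    show "\<exists>\<alpha>. econe E \<alpha> \<and> R E \<alpha> \<theta>" if "scone S E \<theta>" for \<theta>
    proof -
      have "mk \<theta> \<in> FOb (\<Phi> E) ` wcone E ` {\<alpha>. econe E \<alpha>}"
        using bij[OF E] that by (auto simp: bij_betw_def)
      then show ?thesis by (auto simp: R_def)
    qed
    show "(\<forall>X\<in>Ob A. \<forall>x\<in>Obj (F0 W X). \<alpha> X x = \<alpha>' X x) \<longleftrightarrow> (\<forall>X\<in>Ob A. \<theta> X = \<theta>' X)"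
      if "econe E \<alpha>" "econe E \<alpha>'" "R E \<alpha> \<theta>" "R E \<alpha>' \<theta>'" for \<alpha> \<alpha>' \<theta> \<theta>'
    proof -
      have "wcone E \<alpha> = wcone E \<alpha>' \<longleftrightarrow> mk \<theta> = mk \<theta>'"
        using that bij_betw_imp_inj_on[OF bij[OF E]] unfolding R_def
        by (metis (mono_tags, lifting) image_eqI inj_on_eq_iff mem_Collect_eq)
      then show ?thesis by (simp add: wcone_eq_iff eq)
    qed
  next
    fix u \<alpha> \<theta> \<alpha>' \<theta>'
    assume u: "u \<in> Arr C" and \<alpha>: "econe (Cod C u) \<alpha>" and \<theta>: "scone S (Cod C u) \<theta>" and R: "R (Cod C u) \<alpha> \<theta>"
      and \<alpha>': "\<forall>X\<in>Ob A. \<forall>x\<in>Obj (F0 W X). \<alpha>' X x = Cmp C (\<alpha> X x) u" and \<theta>': "\<forall>X\<in>Ob A. \<theta>' X = Cmp C (\<theta> X) u"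
    have eqs: "wcone (Dom C u) \<alpha>' = wcone (Dom C u) (\<lambda>X x. Cmp C (\<alpha> X x) u)" "mk \<theta>' = mk (\<lambda>X. Cmp C (\<theta> X) u)"
      using \<alpha>' \<theta>' by (simp_all add: wcone_eq_iff eq)
    \<comment> \<open>\<open>fcomp\<close> is \<open>undefined\<close> outside the objects of its
      domain, so membership has to be known before the naturality square is evaluated.\<close>
    have mem: "wcone (Cod C u) \<alpha> \<in> Obj (F0 weighted (Cod C u))" using \<alpha> by (auto simp: weighted_Obj)
    have "FDom (F1 weighted u) = F0 weighted (Cod C u)"
      by (simp add: weighted_cones_def weighted_cones1_def Let_def)
    then have "FOb (\<Phi> (Dom C u)) (FOb (F1 weighted u) (wcone (Cod C u) \<alpha>)) =
        FOb (cones1 A B K u) (FOb (\<Phi> (Cod C u)) (wcone (Cod C u) \<alpha>))"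
      using arg_cong[OF sq[OF u], of "\<lambda>h. FOb h (wcone (Cod C u) \<alpha>)"] mem u
      by (simp add: fcomp_def dom C_simps)
    then show "R (Dom C u) \<alpha>' \<theta>'"
      using R by (simp add: R_def eqs weighted_act[OF \<alpha> u] act[OF u \<theta>])
  qed
  then show ?thesis by blast
qed

lemma same_cones_chaotic:
  assumes S: "S \<subseteq> Ar A"
    and "weighted_limit_is_sigma_s_limit A S W B F \<or> weighted_limit_is_sigma_s_oplimit A S W B F"
  shows "\<exists>R. same_cones A S W C G0 G1 R"
  using assms(2) unfolding weighted_limit_is_sigma_s_limit_def weighted_limit_is_sigma_s_oplimit_def
proof
  assume "two_nat_isomorphic (op2 B) weighted (cones A B (sigma_s_cones A S B F))"
  then show ?thesis
    by (rule same_conesI[OF _ sigma_s_cones_Obj[OF S] lax_eq_iff]) (rule lax_act[OF S])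
next
  assume "two_nat_isomorphic (op2 B) weighted (cones A B (sigma_s_opcones A S B F))"
  then show ?thesis
    by (rule same_conesI[OF _ sigma_s_opcones_Obj[OF S] oplax_eq_iff]) (rule oplax_act[OF S])
qed

end

section \<open>Adjoining an object to the indexing category\<close>

text \<open>Transports a category into the type over which the test 2-categories range. Later
  injectivity is asked on the carriers only: the type of collage arrows contains all functions on
  points and may be too large to embed.\<close>

definition relabel :: "('o \<Rightarrow> 'p) \<Rightarrow> ('m \<Rightarrow> 'q) \<Rightarrow> ('o, 'm) cat \<Rightarrow> ('p, 'q) cat" where
  "relabel i j C = \<lparr>Obj = i ` Obj C, Arr = j ` Arr C,
     Dom = (\<lambda>f. i (Dom C (inv_into (Arr C) j f))), Cod = (\<lambda>f. i (Cod C (inv_into (Arr C) j f))),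
     Idt = (\<lambda>X. j (Idt C (inv_into (Obj C) i X))),
     Cmp = (\<lambda>g f. j (Cmp C (inv_into (Arr C) j g) (inv_into (Arr C) j f)))\<rparr>"

lemma relabel_simps:
  assumes "inj_on i (Obj C)" "inj_on j (Arr C)"
  shows "Obj (relabel i j C) = i ` Obj C" "Arr (relabel i j C) = j ` Arr C"
    "f \<in> Arr C \<Longrightarrow> Dom (relabel i j C) (j f) = i (Dom C f)"
    "f \<in> Arr C \<Longrightarrow> Cod (relabel i j C) (j f) = i (Cod C f)"
    "X \<in> Obj C \<Longrightarrow> Idt (relabel i j C) (i X) = j (Idt C X)"
    "f \<in> Arr C \<Longrightarrow> g \<in> Arr C \<Longrightarrow> Cmp (relabel i j C) (j g) (j f) = j (Cmp C g f)"
    "f \<in> Arr C \<Longrightarrow> g \<in> Arr C \<Longrightarrow> j f = j g \<longleftrightarrow> f = g"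
    "X \<in> Obj C \<Longrightarrow> Y \<in> Obj C \<Longrightarrow> i X = i Y \<longleftrightarrow> X = Y"
  using assms by (auto simp: relabel_def inj_on_eq_iff)

lemma category_relabel:
  assumes ij: "inj_on i (Obj C)" "inj_on j (Arr C)" and C: "category C"
  shows "category (relabel i j C)"
  unfolding category_def
  by (auto simp: relabel_simps[OF ij] categoryD[OF C])

lemma functorial_relabel:
  assumes ij: "inj_on i (Obj C)" "inj_on j (Arr C)" and G: "functorial D C G0 G1"
  shows "functorial D (relabel i j C) (\<lambda>X. i (G0 X)) (\<lambda>f. j (G1 f))"
  using G unfolding functorial_def
  by (auto simp: relabel_simps[OF ij])

text \<open>\<open>Pt X c\<close> is the arrow from the new object \<open>None\<close> to \<open>X\<close> given by the point \<open>c\<close> of \<open>T X\<close>.\<close>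

datatype ('o, 'a, 't) collage_arr = Base 'a | Pt 'o 't | En "'t \<Rightarrow> 't"

text \<open>\<open>T\<close> with \<open>act\<close> is a set-valued functor on \<open>A\<close>,
  and \<open>M\<close> is a monoid of natural endomorphisms of it. Keeping \<open>M\<close> a
  parameter allows a choice small enough for the size constraint.\<close>

locale collage =
  fixes A :: "('o, 'a, 'c) two_cat" and T :: "'o \<Rightarrow> 't set" and act :: "'a \<Rightarrow> 't \<Rightarrow> 't" and M :: "('t \<Rightarrow> 't) set"
  assumes A: "two_category A"
    and act_mem: "f \<in> Ar A \<Longrightarrow> c \<in> T (Dom1 A f) \<Longrightarrow> act f c \<in> T (Cod1 A f)"
    and act_id: "X \<in> Ob A \<Longrightarrow> c \<in> T X \<Longrightarrow> act (Id1 A X) c = c"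
    and act_comp: "f \<in> Ar A \<Longrightarrow> g \<in> Ar A \<Longrightarrow> Dom1 A g = Cod1 A f \<Longrightarrow> c \<in> T (Dom1 A f) \<Longrightarrow>
      act (Comp A g f) c = act g (act f c)"
    and M_id: "(\<lambda>c. c) \<in> M"
    and M_comp: "\<phi> \<in> M \<Longrightarrow> \<psi> \<in> M \<Longrightarrow> (\<lambda>c. \<phi> (\<psi> c)) \<in> M"
    and M_mem: "\<phi> \<in> M \<Longrightarrow> X \<in> Ob A \<Longrightarrow> c \<in> T X \<Longrightarrow> \<phi> c \<in> T X"
    and M_act: "\<phi> \<in> M \<Longrightarrow> f \<in> Ar A \<Longrightarrow> c \<in> T (Dom1 A f) \<Longrightarrow> \<phi> (act f c) = act f (\<phi> c)"
begin

lemmas A_simps = two_categoryD1[OF A]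

text \<open>The collage of \<open>T\<close>, seen as a profunctor between \<open>M\<close> and
  \<open>A\<close>. Precomposing a point with \<open>En \<phi>\<close> applies \<open>\<phi>\<close>
  to it, so \<open>En\<close> reverses composition. No arrow leads from an old object to
  \<open>None\<close>; the \<open>undefined\<close> branches belong to non-composable pairs.\<close>

definition coll :: "('o option, ('o, 'a, 't) collage_arr) cat" where
  "coll = \<lparr>Obj = insert None (Some ` Ob A),
     Arr = {f. case f of Base f \<Rightarrow> f \<in> Ar A | Pt X c \<Rightarrow> X \<in> Ob A \<and> c \<in> T X | En \<phi> \<Rightarrow> \<phi> \<in> M},
     Dom = (\<lambda>f. case f of Base f \<Rightarrow> Some (Dom1 A f) | _ \<Rightarrow> None),
     Cod = (\<lambda>f. case f of Base f \<Rightarrow> Some (Cod1 A f) | Pt X c \<Rightarrow> Some X | En \<phi> \<Rightarrow> None),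
     Idt = (\<lambda>X. case X of None \<Rightarrow> En (\<lambda>c. c) | Some X \<Rightarrow> Base (Id1 A X)),
     Cmp = (\<lambda>g f. case f of
         Base f \<Rightarrow> (case g of Base g \<Rightarrow> Base (Comp A g f) | _ \<Rightarrow> undefined)
       | Pt X c \<Rightarrow> (case g of Base g \<Rightarrow> Pt (Cod1 A g) (act g c) | _ \<Rightarrow> undefined)
       | En \<phi> \<Rightarrow> (case g of Pt X c \<Rightarrow> Pt X (\<phi> c) | En \<psi> \<Rightarrow> En (\<lambda>c. \<phi> (\<psi> c)) | _ \<Rightarrow> undefined))\<rparr>"

lemma category_coll: "category coll"
  unfolding category_def
  by (auto simp: coll_def A_simps act_mem act_id act_comp M_id M_comp M_mem M_act
      split: collage_arr.splits)

lemma functorial_coll: "functorial (cat1 A) coll Some Base"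
  unfolding functorial_def by (auto simp: coll_def cat1_def A_simps)

text \<open>\<open>point_nat\<close> and \<open>point_cone\<close> are the two kinds of cones with
  vertex \<open>None\<close>, with an arrow \<open>None\<close> to \<open>Some X\<close> identified
  with a point of \<open>T X\<close>.\<close>

definition point_nat :: "('o, 'a, 'c, 'x, 'y) cat_valued \<Rightarrow> ('o \<Rightarrow> 'x \<Rightarrow> 't) \<Rightarrow> bool" where
  "point_nat W a \<longleftrightarrow> (\<forall>X\<in>Ob A. \<forall>x\<in>Obj (F0 W X). a X x \<in> T X) \<and>
     (\<forall>f\<in>Ar A. \<forall>x\<in>Obj (F0 W (Dom1 A f)). a (Cod1 A f) (FOb (F1 W f) x) = act f (a (Dom1 A f) x))"

definition point_cone :: "'a set \<Rightarrow> ('o \<Rightarrow> 't) \<Rightarrow> bool" where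
  "point_cone S t \<longleftrightarrow> (\<forall>X\<in>Ob A. t X \<in> T X) \<and> (\<forall>f\<in>S. act f (t (Dom1 A f)) = t (Cod1 A f))"

text \<open>The comparison is read off at the vertex \<open>None\<close>; its naturality along the
  endomorphisms \<open>En \<phi>\<close> becomes compatibility of \<open>P\<close> with
  \<open>M\<close>.\<close>

lemma same_cones_coll:
  assumes ij: "inj_on i (Obj coll)" "inj_on j (Arr coll)" and S: "S \<subseteq> Ar A" and W: "two_functor A Cat2 W"
    and R: "same_cones A S W (relabel i j coll) (\<lambda>X. i (Some X)) (\<lambda>f. j (Base f)) R"
  obtains P where
    "\<And>a. point_nat W a \<Longrightarrow> \<exists>t. point_cone S t \<and> P a t"
    "\<And>t. point_cone S t \<Longrightarrow> \<exists>a. point_nat W a \<and> P a t"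
    "\<And>a a' t t'. \<lbrakk>point_nat W a; point_nat W a'; point_cone S t; point_cone S t'; P a t; P a' t'\<rbrakk> \<Longrightarrow>
       (\<forall>X\<in>Ob A. \<forall>x\<in>Obj (F0 W X). a X x = a' X x) \<longleftrightarrow> (\<forall>X\<in>Ob A. t X = t' X)"
    "\<And>\<phi> a t. \<lbrakk>\<phi> \<in> M; point_nat W a; point_cone S t; P a t\<rbrakk> \<Longrightarrow>
       P (\<lambda>X x. \<phi> (a X x)) (\<lambda>X. \<phi> (t X))"
proof -
  let ?C = "relabel i j coll" and ?E = "i None"
  let ?G0 = "\<lambda>X. i (Some X)" and ?G1 = "\<lambda>f. j (Base f)"
  let ?e = "\<lambda>a X x. j (Pt X (a X x))" and ?s = "\<lambda>t X. j (Pt X (t X))"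
  note sm = relabel_simps[OF ij]
  have C: "category ?C" using category_relabel[OF ij category_coll] .
  have arr: "Base f \<in> Arr coll \<longleftrightarrow> f \<in> Ar A" "Pt X c \<in> Arr coll \<longleftrightarrow> X \<in> Ob A \<and> c \<in> T X" "En \<phi> \<in> Arr coll \<longleftrightarrow> \<phi> \<in> M"
    for f X c \<phi> by (auto simp: coll_def)
  have obj: "None \<in> Obj coll" "Some X \<in> Obj coll \<longleftrightarrow> X \<in> Ob A" for X by (auto simp: coll_def)
  have dc: "Dom coll (Base f) = Some (Dom1 A f)" "Cod coll (Base f) = Some (Cod1 A f)" "Dom coll (Pt X c) = None"
    "Cod coll (Pt X c) = Some X" "Dom coll (En \<phi>) = None" "Cod coll (En \<phi>) = None" for f X c \<phi>
    by (simp_all add: coll_def)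
  have cmp: "Cmp coll (Base f) (Pt X c) = Pt (Cod1 A f) (act f c)" "Cmp coll (Pt X c) (En \<phi>) = Pt X (\<phi> c)" for f X c \<phi>
    by (simp_all add: coll_def)
  have idt: "Idt coll None = En (\<lambda>c. c)" by (simp add: coll_def)
  have E: "?E \<in> Obj ?C" by (simp add: sm obj)
  have Eid: "Idt ?C ?E \<in> Arr ?C" "Cod ?C (Idt ?C ?E) = ?E" "Dom ?C (Idt ?C ?E) = ?E"
    using categoryD[OF C] E by auto
  have R1: "\<exists>\<theta>. strict_cone A S ?C ?G0 ?G1 ?E \<theta> \<and> R ?E \<alpha> \<theta>" if "elt_cone A W ?C ?G0 ?G1 ?E \<alpha>" for \<alpha>
    using R E that unfolding same_cones_def by blast
  have R2: "\<exists>\<alpha>. elt_cone A W ?C ?G0 ?G1 ?E \<alpha> \<and> R ?E \<alpha> \<theta>" if "strict_cone A S ?C ?G0 ?G1 ?E \<theta>" for \<theta>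
    using R E that unfolding same_cones_def by blast
  have R3: "(\<forall>X\<in>Ob A. \<forall>x\<in>Obj (F0 W X). \<alpha> X x = \<alpha>' X x) \<longleftrightarrow> (\<forall>X\<in>Ob A. \<theta> X = \<theta>' X)"
    if "elt_cone A W ?C ?G0 ?G1 ?E \<alpha>" "elt_cone A W ?C ?G0 ?G1 ?E \<alpha>'"
      "strict_cone A S ?C ?G0 ?G1 ?E \<theta>" "strict_cone A S ?C ?G0 ?G1 ?E \<theta>'" "R ?E \<alpha> \<theta>" "R ?E \<alpha>' \<theta>'" for \<alpha> \<alpha>' \<theta> \<theta>'
    using R E that unfolding same_cones_def by blast
  have R4: "R ?E \<alpha>' \<theta>'"
    if "u \<in> Arr ?C" "Dom ?C u = ?E" "Cod ?C u = ?E" "elt_cone A W ?C ?G0 ?G1 ?E \<alpha>" "strict_cone A S ?C ?G0 ?G1 ?E \<theta>" "R ?E \<alpha> \<theta>"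
      "\<And>X x. X \<in> Ob A \<Longrightarrow> x \<in> Obj (F0 W X) \<Longrightarrow> \<alpha>' X x = Cmp ?C (\<alpha> X x) u"
      "\<And>X. X \<in> Ob A \<Longrightarrow> \<theta>' X = Cmp ?C (\<theta> X) u" for u \<alpha> \<theta> \<alpha>' \<theta>'
  proof -
    have "\<forall>\<alpha> \<theta> \<alpha>' \<theta>'. elt_cone A W ?C ?G0 ?G1 (Cod ?C u) \<alpha> \<longrightarrow>
        strict_cone A S ?C ?G0 ?G1 (Cod ?C u) \<theta> \<longrightarrow> R (Cod ?C u) \<alpha> \<theta> \<longrightarrow>
        (\<forall>X\<in>Ob A. \<forall>x\<in>Obj (F0 W X). \<alpha>' X x = Cmp ?C (\<alpha> X x) u) \<longrightarrow>
        (\<forall>X\<in>Ob A. \<theta>' X = Cmp ?C (\<theta> X) u) \<longrightarrow> R (Dom ?C u) \<alpha>' \<theta>'"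
      using R that(1) unfolding same_cones_def by blast
    then show ?thesis using that by auto
  qed
  have el: "elt_cone A W ?C ?G0 ?G1 ?E (?e a)" if "point_nat W a" for a
    using that unfolding elt_cone_def point_nat_def
    by (auto simp: sm arr obj dc cmp A_simps)
  have st: "strict_cone A S ?C ?G0 ?G1 ?E (?s t)" if "point_cone S t" for t
    using that S unfolding strict_cone_def point_cone_def
    by (auto simp: sm arr obj dc cmp A_simps subset_iff)
  have pt: "\<exists>c\<in>T X. f = j (Pt X c)" if f: "f \<in> Arr ?C" "Dom ?C f = ?E" "Cod ?C f = i (Some X)" "X \<in> Ob A" for f X
  proof -
    obtain g where g: "g \<in> Arr coll" "f = j g" using f(1) unfolding sm by blast
    then have "Dom coll g = None" "Cod coll g = Some X"
      using f(2-4) categoryD(1,2)[OF category_coll g(1)] by (auto simp: sm obj)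
    then show ?thesis using g by (cases g) (auto simp: arr dc)
  qed
  define P where "P a t = R ?E (?e a) (?s t)" for a t
  show thesis
  proof
    fix a assume a: "point_nat W a"
    obtain \<theta> where \<theta>: "strict_cone A S ?C ?G0 ?G1 ?E \<theta>" "R ?E (?e a) \<theta>" using R1[OF el[OF a]] by blast
    have "\<forall>X. \<exists>c. X \<in> Ob A \<longrightarrow> c \<in> T X \<and> \<theta> X = j (Pt X c)"
      using pt \<theta>(1) unfolding strict_cone_def by blast
    then obtain t where t: "X \<in> Ob A \<Longrightarrow> t X \<in> T X" "X \<in> Ob A \<Longrightarrow> \<theta> X = j (Pt X (t X))" for X by metis
    have "act f (t (Dom1 A f)) = t (Cod1 A f)" if "f \<in> S" for f
    proof -
      have f: "f \<in> Ar A" using that S by auto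
      then have "Cmp ?C (?G1 f) (\<theta> (Dom1 A f)) = \<theta> (Cod1 A f)" using \<theta>(1) that by (simp add: strict_cone_def)
      then show ?thesis using f by (simp add: t A_simps sm arr cmp act_mem)
    qed
    then have "point_cone S t" using t by (simp add: point_cone_def)
    \<comment> \<open>\<open>\<theta>\<close> and the cone built from \<open>t\<close> agree only on
      objects of \<open>A\<close>. Naturality of \<open>R\<close> along the identity of
      \<open>None\<close> allows one to be exchanged for the other.\<close>
    moreover have "P a t"
      unfolding P_def by (rule R4[OF Eid(1,3,2) el[OF a] \<theta>])
        (use a in \<open>auto simp: t sm arr A_simps obj idt cmp M_id point_nat_def\<close>)
    ultimately show "\<exists>t. point_cone S t \<and> P a t" by blast
  next
    fix t assume t: "point_cone S t"
    obtain \<alpha> where \<alpha>: "elt_cone A W ?C ?G0 ?G1 ?E \<alpha>" "R ?E \<alpha> (?s t)" using R2[OF st[OF t]] by blast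
    have "\<forall>X x. \<exists>c. X \<in> Ob A \<longrightarrow> x \<in> Obj (F0 W X) \<longrightarrow> c \<in> T X \<and> \<alpha> X x = j (Pt X c)"
      using pt \<alpha>(1) unfolding elt_cone_def by blast
    then obtain a where a: "X \<in> Ob A \<Longrightarrow> x \<in> Obj (F0 W X) \<Longrightarrow> a X x \<in> T X"
      "X \<in> Ob A \<Longrightarrow> x \<in> Obj (F0 W X) \<Longrightarrow> \<alpha> X x = j (Pt X (a X x))" for X x by metis
    have "a (Cod1 A f) (FOb (F1 W f) x) = act f (a (Dom1 A f) x)" if f: "f \<in> Ar A" "x \<in> Obj (F0 W (Dom1 A f))" for f x
    proof -
      have "\<alpha> (Cod1 A f) (FOb (F1 W f) x) = Cmp ?C (?G1 f) (\<alpha> (Dom1 A f) x)" using \<alpha>(1) f by (simp add: elt_cone_def)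
      moreover have "FOb (F1 W f) x \<in> Obj (F0 W (Cod1 A f))"
        using is_functorD(1)[OF weightD(3)[OF W f(1)]] f by (simp add: weightD[OF W])
      ultimately show ?thesis using f by (simp add: a A_simps sm arr cmp act_mem)
    qed
    then have pa: "point_nat W a" using a by (simp add: point_nat_def)
    \<comment> \<open>Again naturality along the identity, now to replace \<open>\<alpha>\<close> by
      the family built from \<open>a\<close>.\<close>
    moreover have "P a t"
      unfolding P_def by (rule R4[OF Eid(1,3,2) \<alpha>(1) st[OF t] \<alpha>(2)])
        (use t in \<open>auto simp: a sm arr A_simps obj idt cmp M_id point_cone_def\<close>)
    ultimately show "\<exists>a. point_nat W a \<and> P a t" by blast
  next
    fix a a' t t'
    assume *: "point_nat W a" "point_nat W a'" "point_cone S t" "point_cone S t'" "P a t" "P a' t'"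
    then show "(\<forall>X\<in>Ob A. \<forall>x\<in>Obj (F0 W X). a X x = a' X x) \<longleftrightarrow> (\<forall>X\<in>Ob A. t X = t' X)"
      using R3[OF el[OF *(1)] el[OF *(2)] st[OF *(3)] st[OF *(4)]]
      unfolding P_def by (auto simp: sm arr point_nat_def point_cone_def)
  next
    fix \<phi> a t
    assume \<phi>: "\<phi> \<in> M" and a: "point_nat W a" and t: "point_cone S t" and "P a t"
    then have RR: "R ?E (?e a) (?s t)" by (simp add: P_def)
    have u: "j (En \<phi>) \<in> Arr ?C" "Dom ?C (j (En \<phi>)) = ?E" "Cod ?C (j (En \<phi>)) = ?E"
      using \<phi> by (simp_all add: sm arr dc)
    show "P (\<lambda>X x. \<phi> (a X x)) (\<lambda>X. \<phi> (t X))"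
      unfolding P_def by (rule R4[OF u el[OF a] st[OF t] RR])
        (use a t \<phi> in \<open>auto simp: sm arr cmp point_nat_def point_cone_def\<close>)
  qed
qed

end

section \<open>The test presheaf\<close>

text \<open>
  \<open>El x b\<close> stands for an object \<open>x\<close> of \<open>W X\<close>, and \<open>Rp g b\<close> for an arrow \<open>g\<close> with codomain \<open>X\<close>. The flag
  \<open>b\<close> is the factor \<open>2\<close>: for \<open>p\<close> flagged \<open>True\<close>, the pairs \<open>(p, p)\<close> and \<open>(p, Star)\<close> have the form
  \<open>(mark p', cut p')\<close>.
\<close>

datatype ('x, 'a) point = Star | El 'x bool | Rp 'a bool

fun mark :: "('x, 'a) point \<Rightarrow> ('x, 'a) point" where
  "mark Star = Star" | "mark (El x b) = El x True" | "mark (Rp g b) = Rp g True"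

text \<open>Gives the preimage of a pair \<open>(p, Star)\<close>: if \<open>p\<close> is flagged
  \<open>True\<close>, then \<open>mark (fade p) = p\<close> and
  \<open>cut (fade p) = Star\<close>.\<close>

fun fade :: "('x, 'a) point \<Rightarrow> ('x, 'a) point" where
  "fade Star = Star" | "fade (El x b) = El x False" | "fade (Rp g b) = Rp g False"

fun cut :: "('x, 'a) point \<Rightarrow> ('x, 'a) point" where
  "cut Star = Star" | "cut (El x b) = (if b then El x b else Star)" | "cut (Rp g b) = (if b then Rp g b else Star)"

lemma cut_simps:
  "cut p = mark p \<or> cut p = Star" "mark p = p \<Longrightarrow> cut p = p" "cut (fade p) = Star" "mark (fade p) = mark p"
  "mark (mark p) = mark p" "mark (cut p) = cut p" "cut (mark p) = mark p" "cut (cut p) = cut p"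
  by (cases p; simp)+

text \<open>\<open>s X\<close> is the arrow of \<open>S\<close> into \<open>X\<close> from the initial object of its component.\<close>

locale pie_pair =
  fixes A :: "('o, 'a, 'c) two_cat" and S :: "'a set" and W :: "('o, 'a, 'c, 'x, 'y) cat_valued" and s :: "'o \<Rightarrow> 'a"
  assumes A: "two_category A" and S: "S \<subseteq> Ar A" and W: "two_functor A Cat2 W"
    and s_mem: "X \<in> Ob A \<Longrightarrow> s X \<in> S" and s_cod: "X \<in> Ob A \<Longrightarrow> Cod1 A (s X) = X"
    and s_comp: "f \<in> S \<Longrightarrow> Comp A f (s (Dom1 A f)) = s (Cod1 A f)"
    and s_id: "X \<in> Ob A \<Longrightarrow> s (Dom1 A (s X)) = Id1 A (Dom1 A (s X))"
begin

definition act :: "'a \<Rightarrow> ('x, 'a) point \<Rightarrow> ('x, 'a) point" where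
  "act f p = (case p of Star \<Rightarrow> Star | El x b \<Rightarrow> El (FOb (F1 W f) x) b | Rp g b \<Rightarrow> Rp (Comp A f g) b)"

text \<open>The set \<open>T X\<close>. The \<open>Rp\<close> points form the sum of all
  \<open>A(Y,X)\<close>, with \<open>Y\<close> recorded as the domain of the arrow.\<close>

definition pts :: "'o \<Rightarrow> ('x, 'a) point set" where
  "pts X = {p. case p of Star \<Rightarrow> True | El x b \<Rightarrow> x \<in> Obj (F0 W X) | Rp g b \<Rightarrow> g \<in> Ar A \<and> Cod1 A g = X}"

text \<open>
  The Yoneda endomorphism: \<open>c\<close> on the summand represented by \<open>Y\<close>, and the base point elsewhere.
\<close>

definition ev :: "'o \<Rightarrow> ('x, 'a) point \<Rightarrow> ('x, 'a) point \<Rightarrow> ('x, 'a) point" where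
  "ev Y c p = (case p of Rp g b \<Rightarrow> if b \<and> g \<in> Ar A \<and> Dom1 A g = Y then act g c else Star | _ \<Rightarrow> Star)"

text \<open>\<open>ev Y c\<close> absorbs a preceding \<open>cut\<close> but not a preceding
  \<open>mark\<close>, since it kills points flagged \<open>False\<close>; hence the second family.
  Both families are indexed by points, which bounds the size of \<open>M\<close>.\<close>

definition M :: "(('x, 'a) point \<Rightarrow> ('x, 'a) point) set" where
  "M = {\<lambda>p. p, mark, cut} \<union>
     (\<Union>Y\<in>Ob A. \<Union>c\<in>pts Y. {ev Y c, \<lambda>p. ev Y c (mark p)})"

lemma act_simps [simp]:
  "act f Star = Star" "act f (El x b) = El (FOb (F1 W f) x) b" "act f (Rp g b) = Rp (Comp A f g) b"
  by (simp_all add: act_def)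

lemma act_eq_Star [simp]: "act f p = Star \<longleftrightarrow> p = Star"
  by (cases p) auto

lemma pts_simps [simp]:
  "Star \<in> pts X" "El x b \<in> pts X \<longleftrightarrow> x \<in> Obj (F0 W X)" "Rp g b \<in> pts X \<longleftrightarrow> g \<in> Ar A \<and> Cod1 A g = X"
  by (simp_all add: pts_def)

lemma flag_act: "mark (act f p) = act f (mark p)" "cut (act f p) = act f (cut p)" "fade (act f p) = act f (fade p)"
  by (cases p; simp)+

lemma flag_pts: "p \<in> pts X \<Longrightarrow> mark p \<in> pts X" "p \<in> pts X \<Longrightarrow> cut p \<in> pts X" "p \<in> pts X \<Longrightarrow> fade p \<in> pts X"
  by (cases p; simp)+

lemmas A_simps = two_categoryD1[OF A]

lemma W_mem: "f \<in> Ar A \<Longrightarrow> x \<in> Obj (F0 W (Dom1 A f)) \<Longrightarrow> FOb (F1 W f) x \<in> Obj (F0 W (Cod1 A f))"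
  using is_functorD(1)[OF weightD(3)[OF W]] by (simp add: weightD[OF W])

lemma W_id: "X \<in> Ob A \<Longrightarrow> x \<in> Obj (F0 W X) \<Longrightarrow> FOb (F1 W (Id1 A X)) x = x"
  by (simp add: weightD[OF W] fid_def)

lemma W_comp: "f \<in> Ar A \<Longrightarrow> g \<in> Ar A \<Longrightarrow> Dom1 A g = Cod1 A f \<Longrightarrow> x \<in> Obj (F0 W (Dom1 A f)) \<Longrightarrow>
    FOb (F1 W (Comp A g f)) x = FOb (F1 W g) (FOb (F1 W f) x)"
  by (simp add: weightD[OF W] fcomp_def)

lemma act_mem: "f \<in> Ar A \<Longrightarrow> c \<in> pts (Dom1 A f) \<Longrightarrow> act f c \<in> pts (Cod1 A f)"
  by (cases c) (auto simp: A_simps W_mem)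

lemma act_id: "X \<in> Ob A \<Longrightarrow> c \<in> pts X \<Longrightarrow> act (Id1 A X) c = c"
  by (cases c) (auto simp: A_simps W_id)

lemma act_comp: "f \<in> Ar A \<Longrightarrow> g \<in> Ar A \<Longrightarrow> Dom1 A g = Cod1 A f \<Longrightarrow> c \<in> pts (Dom1 A f) \<Longrightarrow>
    act (Comp A g f) c = act g (act f c)"
  by (cases c) (auto simp: A_simps W_comp)

lemma ev_simps [simp]:
  "ev Y c Star = Star" "ev Y c (El x b) = Star"
  "ev Y c (Rp g b) = (if b \<and> g \<in> Ar A \<and> Dom1 A g = Y then act g c else Star)"
  by (simp_all add: ev_def)

lemma ev_cut: "ev Y c (cut p) = ev Y c p"
  by (cases p) auto

lemma ev_pts: "c \<in> pts Y \<Longrightarrow> p \<in> pts X \<Longrightarrow> ev Y c p \<in> pts X"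
  by (cases p) (auto intro: act_mem)

lemma ev_act: "c \<in> pts Y \<Longrightarrow> f \<in> Ar A \<Longrightarrow> p \<in> pts (Dom1 A f) \<Longrightarrow> ev Y c (act f p) = act f (ev Y c p)"
  by (cases p) (auto simp: A_simps act_comp)

lemma flag_ev: "mark (ev Y c p) = ev Y (mark c) p" "cut (ev Y c p) = ev Y (cut c) p"
  by (cases p; simp add: flag_act)+

lemma ev_ev: "Z \<in> Ob A \<Longrightarrow> c \<in> pts Y \<Longrightarrow> c' \<in> pts Z \<Longrightarrow> ev Y c (ev Z c' p) = ev Z (ev Y c c') p"
  by (cases p) (auto simp: ev_act)

lemma M_cases:
  assumes "\<phi> \<in> M"
  obtains "\<phi> = (\<lambda>p. p)" | "\<phi> = mark" | "\<phi> = cut"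
    | Y c where "Y \<in> Ob A" "c \<in> pts Y" "\<phi> = ev Y c"
    | Y c where "Y \<in> Ob A" "c \<in> pts Y" "\<phi> = (\<lambda>p. ev Y c (mark p))"
  using assms unfolding M_def by blast

lemma M_pts: "\<phi> \<in> M \<Longrightarrow> p \<in> pts X \<Longrightarrow> \<phi> p \<in> pts X"
  by (erule M_cases) (auto simp: flag_pts ev_pts)

lemma M_act: "\<phi> \<in> M \<Longrightarrow> f \<in> Ar A \<Longrightarrow> p \<in> pts (Dom1 A f) \<Longrightarrow> \<phi> (act f p) = act f (\<phi> p)"
  by (erule M_cases) (auto simp: flag_pts flag_act ev_act)

lemma M_intros: "(\<lambda>p. p) \<in> M" "mark \<in> M" "cut \<in> M"
    "Y \<in> Ob A \<Longrightarrow> c \<in> pts Y \<Longrightarrow> ev Y c \<in> M" "Y \<in> Ob A \<Longrightarrow> c \<in> pts Y \<Longrightarrow> (\<lambda>p. ev Y c (mark p)) \<in> M"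
  unfolding M_def by blast+

text \<open>The Yoneda principle: a natural endomorphism that fixes the base point, applied after
  \<open>ev Y c\<close>, merely moves the image \<open>c\<close> of the generator. Closure of
  \<open>M\<close> after an \<open>ev\<close> follows.\<close>

lemma M_ev: 
  assumes "\<phi> \<in> M" "Y \<in> Ob A" "c \<in> pts Y"
  shows "\<phi> (ev Y c p) = ev Y (\<phi> c) p"
  using assms(1) by (rule M_cases) (auto simp: flag_ev ev_ev assms flag_pts)

lemma M_comp:
  assumes "\<phi> \<in> M" "\<psi> \<in> M"
  shows "(\<lambda>p. \<phi> (\<psi> p)) \<in> M"
  using assms(2)
proof (cases rule: M_cases)
  case 1
  then show ?thesis using assms(1) by (simp add: eta_contract_eq)
next
  case 2
  show ?thesis using assms(1) unfolding 2
    by (cases rule: M_cases) (auto simp: cut_simps M_intros)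
next
  case 3
  show ?thesis using assms(1) unfolding 3
    by (cases rule: M_cases) (auto simp: cut_simps ev_cut M_intros)
next
  case (4 Y c)
  then show ?thesis using M_intros(4)[OF 4(1) M_pts[OF assms(1) 4(2)]] by (simp add: M_ev[OF assms(1)])
next
  case (5 Y c)
  then show ?thesis using M_intros(5)[OF 5(1) M_pts[OF assms(1) 5(2)]] by (simp add: M_ev[OF assms(1)])
qed

sublocale collage A pts act M
  by unfold_locales (auto intro: A act_mem act_id act_comp M_intros M_comp M_pts M_act)

end

section \<open>Comparing cones through the test presheaf\<close>

text \<open>The assumptions on \<open>P\<close> are the four conclusions of
  \<open>same_cones_coll\<close> for the test presheaf.\<close>

locale corresponding_cones = pie_pair A S W s
  for A :: "('o, 'a, 'c) two_cat" and S :: "'a set" and W :: "('o, 'a, 'c, 'x, 'y) cat_valued" and s :: "'o \<Rightarrow> 'a" +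
  fixes P :: "('o \<Rightarrow> 'x \<Rightarrow> ('x, 'a) point) \<Rightarrow> ('o \<Rightarrow> ('x, 'a) point) \<Rightarrow> bool"
  assumes P_total: "point_nat W a \<Longrightarrow> \<exists>t. point_cone S t \<and> P a t"
    and P_surj: "point_cone S t \<Longrightarrow> \<exists>a. point_nat W a \<and> P a t"
    and P_inj: "\<lbrakk>point_nat W a; point_nat W a'; point_cone S t; point_cone S t'; P a t; P a' t'\<rbrakk> \<Longrightarrow>
       (\<forall>X\<in>Ob A. \<forall>x\<in>Obj (F0 W X). a X x = a' X x) \<longleftrightarrow> (\<forall>X\<in>Ob A. t X = t' X)"
    and P_M: "\<lbrakk>\<phi> \<in> M; point_nat W a; point_cone S t; P a t\<rbrakk> \<Longrightarrow>
       P (\<lambda>X x. \<phi> (a X x)) (\<lambda>X. \<phi> (t X))"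
begin

definition rel :: "('o \<Rightarrow> 'x \<Rightarrow> ('x, 'a) point) \<Rightarrow> ('o \<Rightarrow> ('x, 'a) point) \<Rightarrow> bool" where
  "rel a t \<longleftrightarrow> point_nat W a \<and> point_cone S t \<and> P a t"

lemma S_Ar: "f \<in> S \<Longrightarrow> f \<in> Ar A"
  using S by blast

lemma rel_M: "\<phi> \<in> M \<Longrightarrow> rel a t \<Longrightarrow> rel (\<lambda>X x. \<phi> (a X x)) (\<lambda>X. \<phi> (t X))"
  unfolding rel_def using P_M
  by (auto simp: point_nat_def point_cone_def M_pts M_act A_simps S_Ar simp flip: M_act)

lemma rel_inj:
  assumes "rel a t" "rel a' t'"
  shows "(\<forall>X\<in>Ob A. \<forall>x\<in>Obj (F0 W X). a X x = a' X x) \<longleftrightarrow> (\<forall>X\<in>Ob A. t X = t' X)"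
  using assms P_inj unfolding rel_def by blast

lemma rel_memD:
  assumes "rel a t"
  shows "X \<in> Ob A \<Longrightarrow> x \<in> Obj (F0 W X) \<Longrightarrow> a X x \<in> pts X" "X \<in> Ob A \<Longrightarrow> t X \<in> pts X"
    "f \<in> Ar A \<Longrightarrow> x \<in> Obj (F0 W (Dom1 A f)) \<Longrightarrow> a (Cod1 A f) (FOb (F1 W f) x) = act f (a (Dom1 A f) x)"
    "f \<in> S \<Longrightarrow> act f (t (Dom1 A f)) = t (Cod1 A f)"
  using assms unfolding rel_def point_nat_def point_cone_def by auto

text \<open>Injectivity is applied to the pair \<open>(a, t)\<close> and its image under
  \<open>mark\<close>, so that being flagged \<open>True\<close> throughout passes between the two
  sides.\<close>

lemma rel_marked:
  assumes "rel a t"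
  shows "(\<forall>X\<in>Ob A. \<forall>x\<in>Obj (F0 W X). mark (a X x) = a X x) \<longleftrightarrow> (\<forall>X\<in>Ob A. mark (t X) = t X)"
  by (rule rel_inj[OF rel_M[OF M_intros(2) assms] assms])

text \<open>A single cone \<open>v\<close> encodes both \<open>t = mark v\<close> and
  \<open>t' = cut v\<close>. If \<open>g\<close> corresponds to \<open>v\<close>, compatibility with
  \<open>M\<close> and injectivity give \<open>a = mark g\<close> and \<open>a' = cut g\<close>, and
  \<open>cut\<close> returns either the marked point or \<open>Star\<close>.\<close>

lemma truncation_nat:
  assumes r: "rel a t" "rel a' t'" and m: "\<And>X. X \<in> Ob A \<Longrightarrow> mark (t X) = t X"
    and tr: "\<And>X. X \<in> Ob A \<Longrightarrow> t' X = t X \<or> t' X = Star" and X: "X \<in> Ob A" "x \<in> Obj (F0 W X)"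
  shows "a' X x = a X x \<or> a' X x = Star"
proof -
  define v where "v X = (if t' X = t X then t X else fade (t X))" for X
  \<comment> \<open>\<open>act\<close> neither creates nor destroys \<open>Star\<close>, so along
    \<open>S\<close> the truncation keeps or drops both ends together. This makes \<open>v\<close> a
    cone.\<close>
  have "t' (Dom1 A f) = t (Dom1 A f) \<longleftrightarrow> t' (Cod1 A f) = t (Cod1 A f)" if "f \<in> S" for f
    using tr[of "Dom1 A f"] rel_memD(4)[OF r(1) that] rel_memD(4)[OF r(2) that] that A_simps(1)[OF S_Ar]
    by (metis act_simps(1) act_eq_Star)
  then have "point_cone S v"
    using rel_memD(2,4)[OF r(1)]
    by (auto simp: point_cone_def v_def flag_pts simp flip: flag_act)
  then obtain g where g: "rel g v" using P_surj by (auto simp: rel_def)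
  have "mark (v Z) = t Z" "cut (v Z) = t' Z" if "Z \<in> Ob A" for Z
    using m[OF that] tr[OF that] by (auto simp: v_def cut_simps)
  then have "mark (g X x) = a X x" "cut (g X x) = a' X x"
    using rel_inj[OF rel_M[OF M_intros(2) g] r(1)] rel_inj[OF rel_M[OF M_intros(3) g] r(2)] X by auto
  then show ?thesis using cut_simps(1)[of "g X x"] by auto
qed

text \<open>The same encoding read in the other direction; here \<open>v\<close> has to be natural
  along all arrows of \<open>A\<close>.\<close>

lemma truncation_cone:
  assumes r: "rel a t" "rel a' t'" and m: "\<And>X x. X \<in> Ob A \<Longrightarrow> x \<in> Obj (F0 W X) \<Longrightarrow> mark (a X x) = a X x"
    and tr: "\<And>X x. X \<in> Ob A \<Longrightarrow> x \<in> Obj (F0 W X) \<Longrightarrow> a' X x = a X x \<or> a' X x = Star" and X: "X \<in> Ob A"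
  shows "t' X = t X \<or> t' X = Star"
proof -
  define v where "v X x = (if a' X x = a X x then a X x else fade (a X x))" for X x
  have "a' (Dom1 A f) x = a (Dom1 A f) x \<longleftrightarrow>
      a' (Cod1 A f) (FOb (F1 W f) x) = a (Cod1 A f) (FOb (F1 W f) x)"
    if "f \<in> Ar A" "x \<in> Obj (F0 W (Dom1 A f))" for f x
    using tr[of "Dom1 A f" x] rel_memD(3)[OF r(1) that] rel_memD(3)[OF r(2) that] that A_simps(1)
    by (metis act_simps(1) act_eq_Star)
  then have "point_nat W v"
    using rel_memD(1,3)[OF r(1)]
    by (auto simp: point_nat_def v_def flag_pts flag_act)
  then obtain g where g: "rel v g" using P_total by (auto simp: rel_def)
  have "mark (v Z z) = a Z z" "cut (v Z z) = a' Z z" if "Z \<in> Ob A" "z \<in> Obj (F0 W Z)" for Z z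
    using m[OF that] tr[OF that] by (auto simp: v_def cut_simps)
  then have "mark (g X) = t X" "cut (g X) = t' X"
    using rel_inj[OF rel_M[OF M_intros(2) g] r(1)] rel_inj[OF rel_M[OF M_intros(3) g] r(2)] X by auto
  then show ?thesis using cut_simps(1)[of "g X"] by auto
qed

section \<open>Values at the initial objects of the components of Sigma\<close>

abbreviation "rep X \<equiv> Dom1 A (s X)"

lemma rep_Ob: "X \<in> Ob A \<Longrightarrow> rep X \<in> Ob A" "X \<in> Ob A \<Longrightarrow> s X \<in> Ar A"
  using A_simps(1) S_Ar s_mem by blast+

lemma rep_rep: "X \<in> Ob A \<Longrightarrow> rep (rep X) = rep X"
  by (simp add: s_id rep_Ob A_simps)

lemma rep_S: "f \<in> S \<Longrightarrow> rep (Cod1 A f) = rep (Dom1 A f)"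
  using s_comp[of f] A_simps(7)[OF rep_Ob(2) S_Ar] A_simps(1)[OF S_Ar] s_cod by metis

text \<open>Compatibility along \<open>s X\<close>, which lies in \<open>S\<close>, shows that a
  cone is determined by its values at the initial objects.\<close>

lemma cone_rep: "rel a t \<Longrightarrow> X \<in> Ob A \<Longrightarrow> t X = act (s X) (t (rep X))"
  using rel_memD(4)[of a t "s X"] s_mem s_cod by metis

lemma PIE: "PIE_weight A W"
proof -
  define u :: "'o \<Rightarrow> ('x, 'a) point" where "u X = Rp (s X) True" for X
  define j :: "'o \<Rightarrow> 'x \<Rightarrow> ('x, 'a) point" where "j X x = El x True" for X x
  have "point_cone S u"
    by (auto simp: point_cone_def u_def rep_Ob s_cod s_comp)
  then obtain q where q: "rel q u" using P_surj by (auto simp: rel_def)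
  have "point_nat W j"
    by (auto simp: point_nat_def j_def)
  then obtain d where d: "rel j d" using P_total by (auto simp: rel_def)
  have dm: "mark (d X) = d X" if "X \<in> Ob A" for X
    using rel_marked[OF d] that by (simp add: j_def)
  have qm: "mark (q X x) = q X x" if "X \<in> Ob A" "x \<in> Obj (F0 W X)" for X x
    using rel_marked[OF q] that by (simp add: u_def)
  note d_pts = rel_memD(2)[OF d] and q_pts = rel_memD(1)[OF q] and q_nat = rel_memD(3)[OF q]

  have d_Star: "d Z \<noteq> Star" if Z: "Z \<in> Ob A" for Z
  proof
    assume dZ: "d Z = Star"
    \<comment> \<open>If \<open>d\<close> vanishes at \<open>Z\<close>, it vanishes on the whole
      component, so \<open>d\<close> is a truncation of the cone \<open>t\<close> that has
      \<open>u\<close> there instead. Then \<open>j\<close> is a truncation of the family of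
      \<open>t\<close>; as \<open>j\<close> is nowhere \<open>Star\<close>, both agree, and
      injectivity forces \<open>t = d\<close>, contrary to \<open>u Z\<close> being different from
      \<open>Star\<close>.\<close>
    define t where "t X = (if rep X = rep Z then u X else d X)" for X
    have "point_cone S t"
      using rel_memD(2,4)[OF d] rel_memD(2,4)[OF q] by (auto simp: point_cone_def t_def rep_S)
    then obtain a where a: "rel a t" using P_surj by (auto simp: rel_def)
    have "d (rep Z) = Star" using cone_rep[OF d Z] dZ act_eq_Star by metis
    then have "d X = t X \<or> d X = Star" if "X \<in> Ob A" for X
      using cone_rep[OF d that] by (simp add: t_def)
    then have "j X x = a X x \<or> j X x = Star" if "X \<in> Ob A" "x \<in> Obj (F0 W X)" for X x
      using that by (intro truncation_nat[OF a d]) (auto simp: t_def u_def dm)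
    then have "t Z = d Z" using rel_inj[OF a d] Z by (simp add: j_def)
    then show False by (simp add: dZ t_def u_def)
  qed

  text \<open>\<open>h I\<close> corresponds to the truncation of \<open>d\<close> to the component of \<open>I\<close>.\<close>
  define h where "h I X x = ev I (d I) (q X x)" for I X x
  have h: "rel (h I) (\<lambda>X. ev I (d I) (u X))" if "I \<in> Ob A" for I
    using rel_M[OF M_intros(4)[OF that d_pts[OF that]] q] by (simp add: h_def[abs_def])
  have h_El: "h I X x = El x True \<or> h I X x = Star"
    if I: "I \<in> Ob A" "rep I = I" and X: "X \<in> Ob A" "x \<in> Obj (F0 W X)" for I X x
  proof -
    \<comment> \<open>If \<open>rep Z = I\<close>, the left side is \<open>act (s Z) (d I)\<close>,
      which equals \<open>d Z\<close> by \<open>cone_rep\<close>; otherwise it is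
      \<open>Star\<close>.\<close>
    have "ev I (d I) (u Z) = d Z \<or> ev I (d I) (u Z) = Star" if "Z \<in> Ob A" for Z
      using cone_rep[OF d that] by (auto simp: u_def rep_Ob that)
    then show ?thesis
      using truncation_nat[OF d h[OF I(1)] dm _ X] by (simp add: j_def)
  qed

  define good where "good X x \<longleftrightarrow> (\<exists>g. q X x = Rp g True \<and> rep (Dom1 A g) = Dom1 A g)" for X x
  have good: "good X x" if X: "X \<in> Ob A" "x \<in> Obj (F0 W X)" for X x
  proof -
    \<comment> \<open>\<open>w\<close> truncates \<open>j\<close> to the good elements. It suffices
      that its cone \<open>t\<close> equals \<open>d\<close>, and by \<open>cone_rep\<close> this
      can be tested at the initial objects.\<close>
    define w where "w X x = (if good X x then j X x else Star)" for X x
    have "good (Cod1 A f) (FOb (F1 W f) x) \<longleftrightarrow> good (Dom1 A f) x"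
      if f: "f \<in> Ar A" "x \<in> Obj (F0 W (Dom1 A f))" for f x
      using q_nat[OF f] q_pts[of "Dom1 A f" x] f A_simps(1)[OF f(1)]
      by (cases "q (Dom1 A f) x") (auto simp: good_def A_simps)
    then have "point_nat W w" by (auto simp: point_nat_def w_def j_def)
    then obtain t where t: "rel w t" using P_total by (auto simp: rel_def)
    have td: "t Z = d Z \<or> t Z = Star" if "Z \<in> Ob A" for Z
      using that by (intro truncation_cone[OF d t]) (auto simp: j_def w_def)
    have "t I = d I" if I: "I \<in> Ob A" "rep I = I" for I
    proof -
      \<comment> \<open>\<open>h I\<close> differs from \<open>Star\<close> only where
        \<open>q Z z\<close> is a flagged arrow with domain \<open>I\<close>, hence only at good
        elements. So \<open>h I\<close> is a truncation of \<open>w\<close>, and its cone, whose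
        value at \<open>I\<close> is \<open>d I\<close>, is one of \<open>t\<close>.\<close>
      have "h I Z z = w Z z \<or> h I Z z = Star" if "Z \<in> Ob A" "z \<in> Obj (F0 W Z)" for Z z
        using h_El[OF I that] I(2) by (cases "q Z z") (auto simp: h_def w_def j_def good_def)
      then have "ev I (d I) (u I) = t I \<or> ev I (d I) (u I) = Star"
        by (intro truncation_cone[OF t h[OF I(1)]]) (auto simp: w_def j_def I)
      moreover have "s I = Id1 A I" using s_id[OF I(1)] I(2) by simp
      ultimately show ?thesis
        using d_Star[OF I(1)] I by (simp add: u_def A_simps act_id d_pts)
    qed
    then have "t Z = d Z" if "Z \<in> Ob A" for Z
      using cone_rep[OF t that] cone_rep[OF d that] rep_Ob rep_rep that by simp
    then have "w X x = j X x" using rel_inj[OF t d] X by auto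
    then show ?thesis by (simp add: w_def j_def split: if_splits)
  qed

  have gen: "\<exists>y. d (Dom1 A g) = El y True \<and> y \<in> Obj (F0 W (Dom1 A g)) \<and> FOb (F1 W g) y = x \<and>
      q (Dom1 A g) y = Rp (Id1 A (Dom1 A g)) True"
    if X: "X \<in> Ob A" "x \<in> Obj (F0 W X)" and g: "q X x = Rp g True" for X x g
  proof -
    let ?I = "Dom1 A g"
    have y: "\<exists>y. d (Dom1 A f) = El y True \<and> y \<in> Obj (F0 W (Dom1 A f)) \<and> FOb (F1 W f) y = z"
      if "Z \<in> Ob A" "z \<in> Obj (F0 W Z)" "q Z z = Rp f True" for Z z f
    proof -
      have f: "f \<in> Ar A" using q_pts[OF that(1,2)] that(3) by simp
      have I: "Dom1 A f \<in> Ob A" "rep (Dom1 A f) = Dom1 A f"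
        using good[OF that(1,2)] that(3) f by (auto simp: good_def A_simps)
      \<comment> \<open>The left side is \<open>h (Dom1 A f) Z z\<close>, and \<open>d_Star\<close>
        excludes the base point. Since \<open>act\<close> preserves constructors,
        \<open>d (Dom1 A f)\<close> is itself an \<open>El\<close> point lying over
        \<open>z\<close>.\<close>
      have "act f (d (Dom1 A f)) = El z True"
        using h_El[OF I that(1,2)] d_Star[OF I(1)] by (simp add: h_def that(3) f)
      then show ?thesis using d_pts[OF I(1)] by (cases "d (Dom1 A f)") auto
    qed
    obtain y where y1: "d ?I = El y True" "y \<in> Obj (F0 W ?I)" "FOb (F1 W g) y = x" using y[OF X g] by blast
    have gA: "g \<in> Ar A" "Cod1 A g = X" using q_pts[OF X] g by simp_all
    have I: "?I \<in> Ob A" "rep ?I = ?I" using good[OF X] g gA by (auto simp: good_def A_simps)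
    obtain e where e: "q ?I y = Rp e True" using good[OF I(1) y1(2)] by (auto simp: good_def)
    have eA: "e \<in> Ar A" "Cod1 A e = ?I" using q_pts[OF I(1) y1(2)] e by simp_all
    \<comment> \<open>Naturality of \<open>q\<close> along \<open>g\<close> at the generator
      \<open>y\<close>. Comparing domains, \<open>e\<close> is an endomorphism of
      \<open>?I\<close>.\<close>
    have "Rp (Comp A g e) True = Rp g True" using q_nat[OF gA(1) y1(2)] by (simp add: gA y1 g e)
    then have ge: "Dom1 A e = ?I" using A_simps(7)[OF eA(1) gA(1)] eA by simp
    let ?c = "Rp e True" and ?i = "Rp (Id1 A ?I) True"
    have c: "?c \<in> pts ?I" "?i \<in> pts ?I" using eA I by (simp_all add: A_simps)
    text \<open>Composing with the idempotent \<open>e\<close> does not change \<open>q\<close>, hence not the generic cone \<open>u\<close>.\<close>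
    have "ev ?I ?c (q Z z) = ev ?I ?i (q Z z)" if Z: "Z \<in> Ob A" "z \<in> Obj (F0 W Z)" for Z z
    proof -
      obtain f where f: "q Z z = Rp f True" using good[OF Z] by (auto simp: good_def)
      have fA: "f \<in> Ar A" "Cod1 A f = Z" using q_pts[OF Z] f by simp_all
      show ?thesis
      proof (cases "Dom1 A f = ?I")
        case True
        then have "FOb (F1 W f) y = z" using y[OF Z f] y1 by auto
        then have "Rp (Comp A f e) True = Rp f True"
          using q_nat[OF fA(1), of y] y1(2) True by (simp add: fA f e)
        then show ?thesis using True by (simp add: f fA A_simps)
      qed (simp add: f)
    qed
    then have "ev ?I ?c (u ?I) = ev ?I ?i (u ?I)"
      using rel_inj[OF rel_M[OF M_intros(4)[OF I(1) c(1)] q] rel_M[OF M_intros(4)[OF I(1) c(2)] q]] I(1) by simp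
    moreover have "s ?I = Id1 A ?I" using s_id[OF I(1)] I(2) by simp
    ultimately have "e = Id1 A ?I" using I eA by (simp add: u_def A_simps)
    then show ?thesis using y1 e by auto
  qed

  \<comment> \<open>The initial object of the component of \<open>(x, X)\<close> is to be
    \<open>(y, I)\<close>, where \<open>I\<close> is the domain of the arrow in \<open>q X x\<close>
    and \<open>d I = El y True\<close>. By \<open>good\<close> and \<open>gen\<close> the cases left
    out of both \<open>case\<close> expressions do not arise.\<close>
  define base where "base I = (case d I of El y b \<Rightarrow> (y, I))" for I
  define root where "root = (\<lambda>(x, X). case q X x of Rp g b \<Rightarrow> base (Dom1 A g))"
  have root: "\<exists>g y. q X x = Rp g True \<and> root (x, X) = (y, Dom1 A g) \<and> g \<in> Ar A \<and> Cod1 A g = X \<and>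
      y \<in> Obj (F0 W (Dom1 A g)) \<and> FOb (F1 W g) y = x \<and> q (Dom1 A g) y = Rp (Id1 A (Dom1 A g)) True"
    if X: "X \<in> Ob A" "x \<in> Obj (F0 W X)" for X x
  proof -
    obtain g where g: "q X x = Rp g True" using good[OF X] by (auto simp: good_def)
    show ?thesis using gen[OF X g] q_pts[OF X] by (auto simp: g root_def base_def)
  qed
  let ?E = "elements_cat A W"
  have "components_have_initial ?E"
  proof (subst components_have_initial_iff, goal_cases)
    case (1 f)
    then show ?case by (auto simp: elements_cat_def A_simps W_mem)
  next
    case 2
    show ?case
    proof (intro exI[of _ root] conjI ballI)
      fix p assume "p \<in> Obj ?E"
      then obtain x X where p: "p = (x, X)" and X: "X \<in> Ob A" "x \<in> Obj (F0 W X)"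
        by (auto simp: elements_cat_def)
      obtain g y where g: "q X x = Rp g True" "root (x, X) = (y, Dom1 A g)" "g \<in> Ar A" "Cod1 A g = X"
        and y: "y \<in> Obj (F0 W (Dom1 A g))" "FOb (F1 W g) y = x" "q (Dom1 A g) y = Rp (Id1 A (Dom1 A g)) True"
        using root[OF X] by blast
      show "root p \<in> Obj ?E" using g y by (simp add: p elements_cat_def A_simps)
      \<comment> \<open>Since \<open>q\<close> is the identity at \<open>y\<close>, naturality along
        \<open>f\<close> computes \<open>q X x\<close> to be \<open>f\<close> itself.\<close>
      have "f = g" if f: "f \<in> Ar A" "Dom1 A f = Dom1 A g" "Cod1 A f = X" "FOb (F1 W f) y = x" for f
      proof -
        have "act f (q (Dom1 A g) y) = q X x" using q_nat[OF f(1), of y] y(1) f(2-4) by simp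
        then show ?thesis using A_simps(9)[OF f(1) f(2)[symmetric]] by (simp add: y(3) g(1))
      qed
      then have "a = ((y, Dom1 A g), g, (x, X))"
        if "a \<in> Arr ?E" "Dom ?E a = (y, Dom1 A g)" "Cod ?E a = (x, X)" for a
        using that by (cases a) (simp add: elements_cat_def)
      moreover have "((y, Dom1 A g), g, (x, X)) \<in> Arr ?E"
        using g y by (simp add: elements_cat_def)
      ultimately show "\<exists>!f. f \<in> Arr ?E \<and> Dom ?E f = root p \<and> Cod ?E f = p"
        unfolding p g(2) by (intro ex1I[of _ "((y, Dom1 A g), g, (x, X))"]) (simp_all add: elements_cat_def)
    next
      fix a assume "a \<in> Arr ?E"
      then obtain x f where a: "a = ((x, Dom1 A f), f, (FOb (F1 W f) x, Cod1 A f))"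
        and f: "f \<in> Ar A" "x \<in> Obj (F0 W (Dom1 A f))"
        by (auto simp: elements_cat_def)
      \<comment> \<open>Naturality turns \<open>g\<close> into \<open>Comp A f g\<close>, whose
        domain is that of \<open>g\<close>; \<open>root\<close> depends only on this domain.\<close>
      obtain g where "q (Dom1 A f) x = Rp g True" "g \<in> Ar A" "Cod1 A g = Dom1 A f"
        using root[OF A_simps(1)[OF f(1)] f(2)] by blast
      then show "root (Dom ?E a) = root (Cod ?E a)"
        using q_nat[OF f] f by (simp add: a elements_cat_def root_def A_simps)
    qed
  qed
  then show ?thesis by (simp add: PIE_weight_def)
qed

end

section \<open>Cardinality of the collage\<close>

unbundle cardinal_syntax

context
  fixes U :: "'u set"
  assumes inf: "infinite U"
begin

lemma small_finite: "finite X \<Longrightarrow> |X| \<le>o |U|"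
  using inf card_of_ordLeq_finite[of U X] ordLeq_total[OF card_of_Well_order card_of_Well_order, of X U] by blast

lemma small_Un: "|X| \<le>o |U| \<Longrightarrow> |Y| \<le>o |U| \<Longrightarrow> |X \<union> Y| \<le>o |U|"
  using card_of_UNION_ordLeq_infinite[OF inf small_finite[of "UNIV :: bool set"], of "\<lambda>b. if b then X else Y"]
  by (simp add: UNIV_bool Un_commute)

lemma small_Times: "|X| \<le>o |U| \<Longrightarrow> |Y| \<le>o |U| \<Longrightarrow> |X \<times> Y| \<le>o |U|"
  by (simp add: card_of_Sigma_ordLeq_infinite[OF inf])

end

lemma small_image: "|X| \<le>o |U| \<Longrightarrow> |f ` X| \<le>o |U|"
  using card_of_image ordLeq_transitive by blast

lemma small_subset: "|Y| \<le>o |U| \<Longrightarrow> X \<subseteq> Y \<Longrightarrow> |X| \<le>o |U|"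
  using card_of_mono1 ordLeq_transitive by blast

lemma small_inj: "inj f \<Longrightarrow> |UNIV :: 'b set| \<le>o |UNIV :: 'u set|" for f :: "'b \<Rightarrow> 'u"
  unfolding card_of_ordLeq[symmetric] by blast

lemma small_embedding: "|X| \<le>o |UNIV :: 'u set| \<Longrightarrow> \<exists>f :: _ \<Rightarrow> 'u. inj_on f X"
  unfolding card_of_ordLeq[symmetric] by blast

text \<open>\<open>'u\<close> is infinite because it contains the natural numbers, so finite unions
  and products of sets that embed in it embed again. The arrows of the collage are covered by such
  sets.\<close>

lemma (in pie_pair) collage_embedding:
  fixes \<iota> :: "'o + 'a + 'c + 'x + 'y + nat \<Rightarrow> 'u"
  assumes "inj \<iota>"
  obtains i :: "'o option \<Rightarrow> 'u" and j :: "('o, 'a, ('x, 'a) point) collage_arr \<Rightarrow> 'u" and k :: "'u \<times> 'u \<Rightarrow> 'u"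
  where "inj_on i (Obj coll)" "inj_on j (Arr coll)" "inj k"
proof -
  let ?U = "UNIV :: 'u set"
  have inj: "inj (\<lambda>x. \<iota> (Inl x))" "inj (\<lambda>x. \<iota> (Inr (Inl x)))" "inj (\<lambda>x. \<iota> (Inr (Inr (Inr (Inl x)))))"
    "inj (\<lambda>x. \<iota> (Inr (Inr (Inr (Inr (Inr x))))))"
    using assms by (auto intro!: injI dest: injD)
  have U: "infinite ?U" 
    using finite_image_iff[OF inj(4)] finite_subset[OF subset_UNIV] infinite_UNIV_nat by metis
  note small = small_Un[OF U] small_finite[OF U] small_Times[OF U] small_image inj[THEN small_inj]
  have "|{Star} \<union> (\<lambda>(x, b). El x b) ` (UNIV \<times> UNIV) \<union> (\<lambda>(g, b). Rp g b) ` (UNIV \<times> UNIV) :: ('x, 'a) point set| \<le>o |?U|"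
    by (intro small) auto
  moreover have "p \<in> {Star} \<union> (\<lambda>(x, b). El x b) ` (UNIV \<times> UNIV) \<union> (\<lambda>(g, b). Rp g b) ` (UNIV \<times> UNIV)"
    for p :: "('x, 'a) point"
    by (cases p) auto
  ultimately have points: "|UNIV :: ('x, 'a) point set| \<le>o |?U|"
    by (rule small_subset[OF _ subsetI])
  \<comment> \<open>Parametrizing \<open>M\<close> by pairs of an object and a point avoids counting
    a function space.\<close>
  have "|{\<lambda>p. p, mark, cut} \<union> (\<lambda>(Y, c). ev Y c) ` (UNIV \<times> UNIV) \<union>
      (\<lambda>(Y, c) p. ev Y c (mark p)) ` (UNIV \<times> UNIV)| \<le>o |?U|"
    by (intro small points) auto
  moreover have "\<phi> \<in> {\<lambda>p. p, mark, cut} \<union> (\<lambda>(Y, c). ev Y c) ` (UNIV \<times> UNIV) \<union>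
      (\<lambda>(Y, c) p. ev Y c (mark p)) ` (UNIV \<times> UNIV)" if "\<phi> \<in> M" for \<phi>
    using that by (rule M_cases) auto
  ultimately have M_small: "|M| \<le>o |?U|"
    by (rule small_subset[OF _ subsetI])
  have "|range Base \<union> (\<lambda>(X, c). Pt X c) ` (UNIV \<times> UNIV) \<union> En ` M :: ('o, 'a, ('x, 'a) point) collage_arr set| \<le>o |?U|"
    by (intro small points M_small)
  moreover have "f \<in> range Base \<union> (\<lambda>(X, c). Pt X c) ` (UNIV \<times> UNIV) \<union> En ` M" if "f \<in> Arr coll" for f
    using that by (cases f) (auto simp: coll_def)
  ultimately have "|Arr coll| \<le>o |?U|"
    by (rule small_subset[OF _ subsetI])
  from small_embedding[OF this] obtain j :: "_ \<Rightarrow> 'u" where j: "inj_on j (Arr coll)" ..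
  have "|{None} \<union> range Some :: 'o option set| \<le>o |?U|"
    by (intro small) auto
  moreover have "Obj coll \<subseteq> {None} \<union> range Some"
    by (auto simp: coll_def)
  ultimately have "|Obj coll| \<le>o |?U|"
    by (rule small_subset)
  from small_embedding[OF this] obtain i :: "_ \<Rightarrow> 'u" where i: "inj_on i (Obj coll)" ..
  have "|?U \<times> ?U| \<le>o |?U|" by (intro small_Times[OF U] card_of_mono1 subset_UNIV)
  from small_embedding[OF this] obtain k :: "'u \<times> 'u \<Rightarrow> 'u" where k: "inj k"
    unfolding UNIV_Times_UNIV ..
  show thesis using that[OF i j k] .
qed

section \<open>The weight is PIE\<close>

text \<open>\<open>s X\<close> is the unique arrow of \<open>S\<close> from \<open>\<rho> X\<close>
  to \<open>X\<close>. The equations for composites and identities follow from this uniqueness, as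
  \<open>\<rho>\<close> is constant along \<open>S\<close>.\<close>

lemma pie_pair_exists:
  assumes "PIE_indexing_pair A S" and W: "two_functor A Cat2 W"
  shows "\<exists>s. pie_pair A S W s"
proof -
  have A: "two_category A" and S: "S \<subseteq> Ar A" and S_id: "\<And>X. X \<in> Ob A \<Longrightarrow> Id1 A X \<in> S"
    and S_comp: "\<And>f g. f \<in> S \<Longrightarrow> g \<in> S \<Longrightarrow> Dom1 A g = Cod1 A f \<Longrightarrow> Comp A g f \<in> S"
    and init: "components_have_initial ((cat1 A)\<lparr>Arr := S\<rparr>)"
    using assms(1) unfolding PIE_indexing_pair_def indexing_pair_def by simp_all
  note A_simps = two_categoryD1[OF A]
  have SA: "f \<in> Ar A" "Dom1 A f \<in> Ob A" "Cod1 A f \<in> Ob A" if "f \<in> S" for f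
    using subsetD[OF S that] A_simps(1,2) by simp_all
  have "\<exists>\<rho>. (\<forall>X\<in>Ob A. \<rho> X \<in> Ob A \<and> (\<exists>!f. f \<in> S \<and> Dom1 A f = \<rho> X \<and> Cod1 A f = X)) \<and>
      (\<forall>f\<in>S. \<rho> (Dom1 A f) = \<rho> (Cod1 A f))"
    using components_have_initial_iff[of "(cat1 A)\<lparr>Arr := S\<rparr>"] init SA by (simp add: cat1_def)
  then obtain \<rho> where \<rho>: "\<And>X. X \<in> Ob A \<Longrightarrow> \<rho> X \<in> Ob A"
      "\<And>X. X \<in> Ob A \<Longrightarrow> \<exists>!f. f \<in> S \<and> Dom1 A f = \<rho> X \<and> Cod1 A f = X"
    and \<rho>_S: "\<And>f. f \<in> S \<Longrightarrow> \<rho> (Dom1 A f) = \<rho> (Cod1 A f)"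
    by blast
  define s where "s X = (THE f. f \<in> S \<and> Dom1 A f = \<rho> X \<and> Cod1 A f = X)" for X
  have s: "s X \<in> S" "Dom1 A (s X) = \<rho> X" "Cod1 A (s X) = X" if "X \<in> Ob A" for X
    using theI'[OF \<rho>(2)[OF that]] by (simp_all add: s_def)
  have s_unique: "f = s X" if "X \<in> Ob A" "f \<in> S" "Dom1 A f = \<rho> X" "Cod1 A f = X" for f X
    using the1_equality[OF \<rho>(2)[OF that(1)], of f] that by (simp add: s_def)
  have \<rho>\<rho>: "\<rho> (\<rho> X) = \<rho> X" if "X \<in> Ob A" for X
    using \<rho>_S[OF s(1)[OF that]] s[OF that] by simp
  have "pie_pair A S W s"
  proof
    show "two_category A" "S \<subseteq> Ar A" "two_functor A Cat2 W" by fact+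
    show "s X \<in> S" "Cod1 A (s X) = X" if "X \<in> Ob A" for X using s[OF that] by simp_all
    show "Comp A f (s (Dom1 A f)) = s (Cod1 A f)" if f: "f \<in> S" for f
      using s[OF SA(2)[OF f]] SA[OF f] SA(1)[OF s(1)[OF SA(2)[OF f]]] S_comp[OF s(1)[OF SA(2)[OF f]] f] \<rho>_S[OF f]
      by (intro s_unique) (simp_all add: A_simps)
    show "s (Dom1 A (s X)) = Id1 A (Dom1 A (s X))" if X: "X \<in> Ob A" for X
      using s_unique[of "\<rho> X" "Id1 A (\<rho> X)"] s(2)[OF X] \<rho>(1)[OF X] \<rho>\<rho>[OF X] S_id[OF \<rho>(1)[OF X]]
      by (simp add: A_simps)
  qed
  then show ?thesis by blast
qed

theorem proposition2p17:
  fixes A :: "('o, 'a, 'c) two_cat"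
    and S :: "'a set"
    and W :: "('o, 'a, 'c, 'x, 'y) cat_valued"
    and \<iota> :: "'o + 'a + 'c + 'x + 'y + nat \<Rightarrow> 'u"
  assumes "inj \<iota>"
    and "PIE_indexing_pair A S"
    and "two_functor A Cat2 W"
  shows "((\<forall>(B :: ('u, 'u, 'u) two_cat) F. two_category B \<longrightarrow> two_functor A B F \<longrightarrow>
             weighted_limit_is_sigma_s_limit A S W B F) \<longrightarrow> PIE_weight A W) \<and>
         ((\<forall>(B :: ('u, 'u, 'u) two_cat) F. two_category B \<longrightarrow> two_functor A B F \<longrightarrow>
             weighted_limit_is_sigma_s_oplimit A S W B F) \<longrightarrow> PIE_weight A W)"
proof -
  obtain s where "pie_pair A S W s"
    using pie_pair_exists[OF assms(2,3)] by (rule exE)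
  then interpret pie_pair A S W s .
  obtain i :: "'o option \<Rightarrow> 'u" and j :: "('o, 'a, ('x, 'a) point) collage_arr \<Rightarrow> 'u" and k :: "'u \<times> 'u \<Rightarrow> 'u"
    where i: "inj_on i (Obj coll)" and j: "inj_on j (Arr coll)" and k: "inj k"
    using collage_embedding[OF assms(1)] .
  let ?C = "relabel i j coll" and ?G0 = "\<lambda>X. i (Some X)" and ?G1 = "\<lambda>f. j (Base f)"
  interpret ch: chaotic_cones A W ?C ?G0 ?G1 k
    by (rule chaotic_cones.intro[OF A assms(3) category_relabel[OF i j category_coll]
          functorial_relabel[OF i j functorial_coll] k])
  let ?B = "chaotic k ?C" and ?F = "chaotic_ext A k ?G0 ?G1"
  have B: "two_category ?B" "two_functor A ?B ?F"
    using two_category_chaotic[OF ch.C k] two_functor_chaotic_ext[OF A ch.C k ch.G] .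
  \<comment> \<open>The same pair \<open>?B\<close>, \<open>?F\<close> refutes non-PIE weights for
    limits and for oplimits, so both claims are instances of this disjunctive form.\<close>
  have "PIE_weight A W"
    if lim: "weighted_limit_is_sigma_s_limit A S W ?B ?F \<or> weighted_limit_is_sigma_s_oplimit A S W ?B ?F"
  proof -
    obtain R where R: "same_cones A S W ?C ?G0 ?G1 R" using ch.same_cones_chaotic[OF S lim] by (rule exE)
    show ?thesis
    proof (rule same_cones_coll[OF i j S assms(3) R], goal_cases)
      case (1 P)
      have "corresponding_cones A S W s P"
        using 1 by unfold_locales
      then show ?case by (rule corresponding_cones.PIE)
    qed
  qed
  then show ?thesis using B by blast
qed

end
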